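(* Let $\kappa\leq\lambda$ be infinite cardinals with $\kappa$ regular, and assume $\lambda^{<\kappa}=\lambda<\lambda^{\kappa}$. Then there exist a positively totally ordered monoid $\mathbb{S}$, a partial function $\mathsf{Sum}:{}^{<\mathrm{On}}\mathbb{S}\to\mathbb{S}$ satisfying (S1) but not (S2), and a non-$\lambda$-Dirac, continuous weak $\lambda^+$-measure space $({}^{\kappa}\lambda,\mathfrak{M},\mu)$ on ${}^{\kappa}\lambda$ with $\mu$ taking values in $(\mathbb{S},\mathsf{Sum})$.
   Context: **Topology.** ${}^{\kappa}\lambda$ is the set of sequences of elements of $\lambda$ of length $\kappa$, with the bounded topology, generated by the cones $\mathbf{N}_s=\{x\in{}^{\kappa}\lambda\mid s\subseteq x\}$ for $s\in{}^{<\kappa}\lambda=\bigcup_{\alpha<\kappa}{}^{\alpha}\lambda$. **Monoids and sums.** A positively totally ordered monoid is $\mathbb{S}=(S,0,+,\leq)$ where $+$ is associative (not necessarily commutative) with neutral element $0$, $\leq$ is a total order, $a\leq b$ and $c\leq d$ imply $a+c\leq b+d$, $0$ is the minimum of $\leq$, and $S\neq\{0\}$. ${}^{<\mathrm{On}}\mathbb{S}$ is the class of all sequences of elements of $S$ of ordinal length; $\mathrm{lh}(s)$ is the length of $s$. For a partial function $\mathsf{Sum}:{}^{<\mathrm{On}}\mathbb{S}\to\mathbb{S}$ consider the axioms: (S1) $\mathsf{Sum}(\emptyset)=0$ and $\mathsf{Sum}(s)=s_0+\dots+s_n$ for every non-empty finite $s=(s_i)_{i\leq n}\in\mathrm{dom}(\mathsf{Sum})$;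 (S2) (continuity) for all $s\in\mathrm{dom}(\mathsf{Sum})$ of limit length, if $s\restriction\alpha\in\mathrm{dom}(\mathsf{Sum})$ for cofinally many $\alpha<\mathrm{lh}(s)$, then $\mathsf{Sum}(s)=\sup\{\mathsf{Sum}(s\restriction\alpha)\mid\alpha<\mathrm{lh}(s),\ s\restriction\alpha\in\mathrm{dom}(\mathsf{Sum})\}$. **Measures.** (In this statement $\mathsf{Sum}$ is not required to satisfy (S2).) A weakly $\lambda^+$-measurable space is a pair $(X,\mathfrak{M})$ where $X$ is a topological space and $\mathfrak{M}$ is a family of subsets of $X$ closed under unions of size $\leq\lambda$ and containing all open subsets of $X$. A $\lambda^+$-measure on it with values in $(\mathbb{S},\mathsf{Sum})$ is a partial function $\mu:\mathscr{P}(X)\to\mathbb{S}$ with $\mathfrak{M}\subseteq\mathrm{dom}(\mu)$ such that: (M1) $\mu(\emptyset)=0$; (M2) $\mu(X)>0$; (M3) $A\subseteq B$ implies $\mu(A)\leq\mu(B)$ for all $A,B\in\mathfrak{M}$; (M4) for every family $(A_i)_{i<\gamma}$ of pairwise disjoint sets of $\mathfrak{M}$ of length an ordinal $\gamma<\lambda^+$, we have $\langle\mu(A_i)\mid i<\gamma\rangle\in\mathrm{dom}(\mathsf{Sum})$ and $\mu(\bigcup_{i<\gamma}A_i)=\mathsf{Sum}(\langle\mu(A_i)\mid i<\gamma\rangle)$; (M5) for every $x\in X$ with $\{x\}\in\mathfrak{M}$ and every open local basis $\{A_i\mid i<\gamma\}$ at $x$ with $\gamma<\lambda^+$, $\mu(\{x\})=\inf_{i<\gamma}\mu(A_i)$.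 Then $(X,\mathfrak{M},\mu)$ is called a weak $\lambda^+$-measure space. It is continuous if $\{x\}\in\mathfrak{M}$ and $\mu(\{x\})=0$ for every $x\in X$. The support of $\mu$ is $\mathrm{supp}(\mu)=X\setminus\bigcup\{O\mid O\text{ open},\ \mu(O)=0\}$. For a cardinal $\gamma$, $\mu$ is $\gamma$-Dirac if $\mathrm{supp}(\mu)$ has weight strictly less than $\gamma$. *)

theory Defs
  imports
    "HOL-Algebra.Group"
    "HOL-Analysis.Abstract_Topology"
    "HOL-Library.Disjoint_Sets"
begin

unbundle cardinal_syntax

section \<open>The generalized Baire space\<close>

text \<open>
  Cardinals are cardinal orders \<open>\<kappa> :: 'k rel\<close>, \<open>lam :: 'l rel\<close>. The ordinals below \<open>\<kappa>\<close> are
  represented by the elements \<open>\<alpha>\<close> of \<open>Field \<kappa>\<close>, the set of predecessors of \<open>\<alpha>\<close> being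
  \<open>underS \<kappa> \<alpha>\<close>. A sequence of length \<open>\<alpha> < \<kappa>\<close> is a partial map with domain \<open>underS \<kappa> \<alpha>\<close>.
\<close>

definition short_seqs :: "'k rel \<Rightarrow> 'l rel \<Rightarrow> ('k \<rightharpoonup> 'l) set" where
  "short_seqs \<kappa> lam = {s. \<exists>\<alpha>\<in>Field \<kappa>. dom s = underS \<kappa> \<alpha> \<and> ran s \<subseteq> Field lam}"

definition long_seqs :: "'k rel \<Rightarrow> 'l rel \<Rightarrow> ('k \<Rightarrow> 'l) set" where
  "long_seqs \<kappa> lam = Func (Field \<kappa>) (Field lam)"

definition cone :: "'k rel \<Rightarrow> 'l rel \<Rightarrow> ('k \<rightharpoonup> 'l) \<Rightarrow> ('k \<Rightarrow> 'l) set" where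
  "cone \<kappa> lam s = {x \<in> long_seqs \<kappa> lam. s \<subseteq>\<^sub>m (Some \<circ> x)}"

definition bounded_topology :: "'k rel \<Rightarrow> 'l rel \<Rightarrow> ('k \<Rightarrow> 'l) topology" where
  "bounded_topology \<kappa> lam = topology_generated_by (cone \<kappa> lam ` short_seqs \<kappa> lam)"


section \<open>Weight\<close>

definition is_base :: "'x topology \<Rightarrow> 'x set set \<Rightarrow> bool" where
  "is_base T \<B> \<longleftrightarrow> openin T = arbitrary union_of (\<lambda>B. B \<in> \<B>)"

definition weight :: "'x topology \<Rightarrow> 'x set rel" where
  "weight T = |SOME \<B>. is_base T \<B> \<and> (\<forall>\<C>. is_base T \<C> \<longrightarrow> |\<B>| \<le>o |\<C>| )|"

text \<open>The base chosen in the definition of \<open>weight\<close> exists.\<close>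

lemma is_base_openin: "is_base T {U. openin T U}"
proof -
  have "(arbitrary union_of openin T) U \<longleftrightarrow> openin T U" for U
    by (auto simp: union_of_def arbitrary_def intro: exI[of _ "{U}"])
  then show ?thesis
    by (simp add: is_base_def fun_eq_iff)
qed

lemma weight_witness:
  obtains \<B> where "is_base T \<B>" "weight T = |\<B>|" "\<And>\<C>. is_base T \<C> \<Longrightarrow> |\<B>| \<le>o |\<C>|"
proof -
  let ?R = "card_of ` {\<B>. is_base T \<B>}"
  have "\<exists>r\<in>?R. \<forall>r'\<in>?R. r \<le>o r'"
    by (rule exists_minim_Well_order) (use is_base_openin[of T] card_of_Well_order in auto)
  then have "\<exists>\<B>. is_base T \<B> \<and> (\<forall>\<C>. is_base T \<C> \<longrightarrow> |\<B>| \<le>o |\<C>| )"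
    by auto
  from someI_ex[OF this] show ?thesis
    by (intro that[of "SOME \<B>. is_base T \<B> \<and> (\<forall>\<C>. is_base T \<C> \<longrightarrow> |\<B>| \<le>o |\<C>| )"])
      (auto simp: weight_def)
qed


section \<open>Positively totally ordered monoids\<close>

text \<open>
  The monoid operation, which need not be commutative, is written \<open>\<otimes>\<close> and its neutral element \<open>\<one>\<close>,
  as in \<open>HOL-Algebra\<close>; in the additive notation these are \<open>+\<close> and \<open>0\<close>.
\<close>

record 'm ordered_monoid = "'m monoid" +
  leq :: "'m rel"

locale pos_tot_ord_monoid = monoid S for S :: "'m ordered_monoid" (structure) +
  assumes linear: "linear_order_on (carrier S) (leq S)"
    and add_mono: "\<lbrakk>(a, b) \<in> leq S; (c, d) \<in> leq S\<rbrakk> \<Longrightarrow> (a \<otimes> c, b \<otimes> d) \<in> leq S"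
    and zero_min: "a \<in> carrier S \<Longrightarrow> (\<one>, a) \<in> leq S"
    and nontrivial: "carrier S \<noteq> {\<one>}"

definition is_sup :: "'m ordered_monoid \<Rightarrow> 'm set \<Rightarrow> 'm \<Rightarrow> bool" where
  "is_sup S A x \<longleftrightarrow> x \<in> carrier S \<and> (\<forall>a\<in>A. (a, x) \<in> leq S) \<and>
    (\<forall>y\<in>carrier S. (\<forall>a\<in>A. (a, y) \<in> leq S) \<longrightarrow> (x, y) \<in> leq S)"

definition is_inf :: "'m ordered_monoid \<Rightarrow> 'm set \<Rightarrow> 'm \<Rightarrow> bool" where
  "is_inf S A x \<longleftrightarrow> x \<in> carrier S \<and> (\<forall>a\<in>A. (x, a) \<in> leq S) \<and>
    (\<forall>y\<in>carrier S. (\<forall>a\<in>A. (y, a) \<in> leq S) \<longrightarrow> (y, x) \<in> leq S)"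


section \<open>Transfinite sums\<close>

text \<open>
  A well-ordered type \<open>'o\<close> plays the role of the class of all ordinals: \<open>\<gamma> :: 'o\<close> represents the
  order type of \<open>{..<\<gamma>}\<close>; if \<open>lam <o |UNIV :: 'o set|\<close>, then every ordinal below \<open>lam\<^sup>+\<close> is so
  represented. A sequence of length \<open>\<gamma>\<close> is a partial map with domain \<open>{..<\<gamma>}\<close>.
  The restriction of \<open>s\<close> to \<open>\<alpha>\<close> is \<open>s |` {..<\<alpha>}\<close>.
\<close>

definition ord_seqs :: "'m ordered_monoid \<Rightarrow> ('o::wellorder \<rightharpoonup> 'm) set" where
  "ord_seqs S = {s. (\<exists>\<gamma>. dom s = {..<\<gamma>}) \<and> ran s \<subseteq> carrier S}"

definition lh :: "('o::wellorder \<rightharpoonup> 'm) \<Rightarrow> 'o" where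
  "lh s = (THE \<gamma>. dom s = {..<\<gamma>})"

definition is_limit :: "'o::wellorder \<Rightarrow> bool" where
  "is_limit \<gamma> \<longleftrightarrow> (\<exists>\<beta>. \<beta> < \<gamma>) \<and> (\<forall>\<beta><\<gamma>. \<exists>\<delta><\<gamma>. \<beta> < \<delta>)"

definition partial_Sum :: "'m ordered_monoid \<Rightarrow> (('o::wellorder \<rightharpoonup> 'm) \<rightharpoonup> 'm) \<Rightarrow> bool" where
  "partial_Sum S \<sigma> \<longleftrightarrow> dom \<sigma> \<subseteq> ord_seqs S \<and> ran \<sigma> \<subseteq> carrier S"

definition finite_sum :: "'m ordered_monoid \<Rightarrow> ('o::wellorder \<rightharpoonup> 'm) \<Rightarrow> 'm" where
  "finite_sum S s =
    foldr (mult S) (map (\<lambda>i. the (s i)) (sorted_list_of_set (dom s))) (one S)"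

definition Sum_S1 :: "'m ordered_monoid \<Rightarrow> (('o::wellorder \<rightharpoonup> 'm) \<rightharpoonup> 'm) \<Rightarrow> bool" where
  "Sum_S1 S \<sigma> \<longleftrightarrow> \<sigma> Map.empty = Some (one S) \<and>
    (\<forall>s\<in>dom \<sigma>. finite (dom s) \<and> dom s \<noteq> {} \<longrightarrow> \<sigma> s = Some (finite_sum S s))"

definition Sum_S2 :: "'m ordered_monoid \<Rightarrow> (('o::wellorder \<rightharpoonup> 'm) \<rightharpoonup> 'm) \<Rightarrow> bool" where
  "Sum_S2 S \<sigma> \<longleftrightarrow>
    (\<forall>s\<in>dom \<sigma>. is_limit (lh s) \<and>
        (\<forall>\<beta><lh s. \<exists>\<alpha><lh s. \<beta> \<le> \<alpha> \<and> s |` {..<\<alpha>} \<in> dom \<sigma>) \<longrightarrow>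
      is_sup S {the (\<sigma> (s |` {..<\<alpha>})) | \<alpha>. \<alpha> < lh s \<and> s |` {..<\<alpha>} \<in> dom \<sigma>} (the (\<sigma> s)))"


section \<open>Weak measure spaces\<close>

definition weakly_measurable_space :: "'l rel \<Rightarrow> 'x topology \<Rightarrow> 'x set set \<Rightarrow> bool" where
  "weakly_measurable_space lam T \<MM> \<longleftrightarrow>
    \<MM> \<subseteq> Pow (topspace T) \<and>
    (\<forall>\<A>. \<A> \<subseteq> \<MM> \<and> |\<A>| \<le>o lam \<longrightarrow> \<Union>\<A> \<in> \<MM>) \<and>
    (\<forall>U. openin T U \<longrightarrow> U \<in> \<MM>)"

definition local_basis_at :: "'x topology \<Rightarrow> 'x \<Rightarrow> 'x set set \<Rightarrow> bool" where
  "local_basis_at T x \<A> \<longleftrightarrow> (\<forall>A\<in>\<A>. openin T A \<and> x \<in> A) \<and>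
    (\<forall>U. openin T U \<and> x \<in> U \<longrightarrow> (\<exists>A\<in>\<A>. A \<subseteq> U))"

text \<open>For an ordinal \<open>\<gamma>\<close>, \<open>\<gamma> < lam\<^sup>+\<close> holds iff the cardinality of \<open>\<gamma>\<close> is less than \<open>lam\<^sup>+\<close>.\<close>

locale weak_measure_space =
  fixes lam :: "'l rel"
    and S :: "'m ordered_monoid" (structure)
    and \<sigma> :: "('o::wellorder \<rightharpoonup> 'm) \<rightharpoonup> 'm"
    and T :: "'x topology"
    and \<MM> :: "'x set set"
    and \<mu> :: "'x set \<rightharpoonup> 'm"
  assumes measurable: "weakly_measurable_space lam T \<MM>"
    and dom_subset: "dom \<mu> \<subseteq> Pow (topspace T)"
    and ran_subset: "ran \<mu> \<subseteq> carrier S"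
    and measurable_subset_dom: "\<MM> \<subseteq> dom \<mu>"
    and M1: "\<mu> {} = Some \<one>"
    and M2: "(\<one>, the (\<mu> (topspace T))) \<in> leq S" "the (\<mu> (topspace T)) \<noteq> \<one>"
    and M3: "\<lbrakk>A \<in> \<MM>; B \<in> \<MM>; A \<subseteq> B\<rbrakk> \<Longrightarrow> (the (\<mu> A), the (\<mu> B)) \<in> leq S"
    and M4: "\<lbrakk>|{..<\<gamma>}| <o cardSuc lam; \<And>i. i < \<gamma> \<Longrightarrow> F i \<in> \<MM>; disjoint_family_on F {..<\<gamma>}\<rbrakk>
      \<Longrightarrow> (\<mu> \<circ> F) |` {..<\<gamma>} \<in> dom \<sigma> \<and> \<mu> (\<Union>i<\<gamma>. F i) = \<sigma> ((\<mu> \<circ> F) |` {..<\<gamma>})"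
    and M5: "\<lbrakk>x \<in> topspace T; {x} \<in> \<MM>; |{..<\<gamma>}| <o cardSuc lam; local_basis_at T x (F ` {..<\<gamma>})\<rbrakk>
      \<Longrightarrow> is_inf S ((\<lambda>i. the (\<mu> (F i))) ` {..<\<gamma>}) (the (\<mu> {x}))"

definition continuous_measure ::
    "'m ordered_monoid \<Rightarrow> 'x topology \<Rightarrow> 'x set set \<Rightarrow> ('x set \<rightharpoonup> 'm) \<Rightarrow> bool" where
  "continuous_measure S T \<MM> \<mu> \<longleftrightarrow> (\<forall>x\<in>topspace T. {x} \<in> \<MM> \<and> \<mu> {x} = Some (one S))"

definition supp :: "'m ordered_monoid \<Rightarrow> 'x topology \<Rightarrow> ('x set \<rightharpoonup> 'm) \<Rightarrow> 'x set" where
  "supp S T \<mu> = topspace T - \<Union>{U. openin T U \<and> \<mu> U = Some (one S)}"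

definition Dirac ::
    "'c rel \<Rightarrow> 'm ordered_monoid \<Rightarrow> 'x topology \<Rightarrow> ('x set \<rightharpoonup> 'm) \<Rightarrow> bool" where
  "Dirac \<gamma> S T \<mu> \<longleftrightarrow> weight (subtopology T (supp S T \<mu>)) <o \<gamma>"

end

theory Submission
  imports Defs
begin

text \<open>
  Call a set small if it has at most \<open>lam\<close> elements, and let \<open>\<MM>\<close> consist of the sets that are
  open up to a small set. An ideal of negligible sets is given by the thin sets, which inside every
  cone miss some subcone up to a small set; cones are not thin, since \<open>lam <o lam ^c \<kappa>\<close> and
  \<open>|short_seqs \<kappa> lam| =o lam\<close> force every cone to have more than \<open>lam\<close> elements.
  The measure maps \<open>A\<close> to the indicator of the set of ultrafilters \<open>p\<close> with \<open>A \<in> p\<close>, where \<open>p\<close>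
  ranges over the ultrafilters that contain no thin set and, for some level of the tree, no cone of
  that level. It is finitely additive for pointwise addition. Comparing values lexicographically,
  with ultrafilters of small level first, makes the cones around a point shrink to 0.
  For unions of \<open>lam\<close> many sets only the following is needed: \<open>\<mu> A\<close> determines \<open>A\<close> up to a thin set, in a
  form that is inherited by such unions, so the sequence of the measures determines the
  measure of the union. Each infinite sequence not arising in this way is given the sum 0,
  and this violates (S2).
\<close>

section \<open>Lexicographically ordered functions\<close>

text \<open>For a well-order \<open>R\<close> this says that \<open>g\<close> is zero or positive at
  the first point of its support. It is the positive cone of the lexicographic order on
  integer-valued functions.\<close>

definition lex_nonneg :: "'i rel \<Rightarrow> ('i \<Rightarrow> int) \<Rightarrow> bool" where
  "lex_nonneg R g \<longleftrightarrow> (\<forall>p. (\<forall>q. (q, p) \<in> R \<longrightarrow> g q = 0) \<longrightarrow> 0 \<le> g p)"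

lemma lex_nonneg_if_nonneg: "(\<And>p. 0 \<le> g p) \<Longrightarrow> lex_nonneg R g"
  by (simp add: lex_nonneg_def)

text \<open>If the sum vanishes below \<open>p\<close>, then so do both summands: by induction along
  \<open>R\<close> each is nonnegative at every earlier point, and nonnegative integers with sum 0
  are 0.\<close>

lemma lex_nonneg_add:
  assumes "wf R" "trans R" "lex_nonneg R g" "lex_nonneg R h"
  shows "lex_nonneg R (\<lambda>p. g p + h p)"
  unfolding lex_nonneg_def
proof (intro allI impI)
  fix p assume p: "\<forall>q. (q, p) \<in> R \<longrightarrow> g q + h q = 0"
  have "(q, p) \<in> R \<Longrightarrow> g q = 0 \<and> h q = 0" for q
    using \<open>wf R\<close>
  proof (induction q rule: wf_induct_rule)
    case (less q)
    then have "(q', q) \<in> R \<Longrightarrow> g q' = 0 \<and> h q' = 0" for q'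
      using \<open>trans R\<close> by (meson transD)
    then have "0 \<le> g q" "0 \<le> h q"
      using assms(3,4) by (auto simp: lex_nonneg_def)
    then show ?case
      using p less.prems by (auto simp: add_nonneg_eq_0_iff)
  qed
  then have "0 \<le> g p" "0 \<le> h p"
    using assms(3,4) by (auto simp: lex_nonneg_def)
  then show "0 \<le> g p + h p" by simp
qed

lemma lex_nonneg_antisym:
  assumes "wf R" "lex_nonneg R g" "lex_nonneg R (\<lambda>p. - g p)"
  shows "g p = 0"
  using \<open>wf R\<close>
proof (induction p rule: wf_induct_rule)
  case (less p)
  then show ?case
    using assms(2,3) by (force simp: lex_nonneg_def)
qed

lemma lex_nonneg_total:
  assumes "total_on I R" "\<And>p. p \<notin> I \<Longrightarrow> g p = 0" "\<not> lex_nonneg R g"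
  shows "lex_nonneg R (\<lambda>p. - g p)"
proof -
  obtain p where p: "g p < 0" "\<And>q. (q, p) \<in> R \<Longrightarrow> g q = 0"
    using assms(3) by (auto simp: lex_nonneg_def not_le)
  show ?thesis
    unfolding lex_nonneg_def
  proof (intro allI impI)
    fix p' assume p': "\<forall>q. (q, p') \<in> R \<longrightarrow> - g q = 0"
    \<comment> \<open>Here \<open>p\<close> is the first point where \<open>g\<close> is nonzero,
      and \<open>g p < 0\<close>. If \<open>p'\<close> precedes \<open>p\<close> or lies off
      \<open>I\<close>, then \<open>g p' = 0\<close>. If \<open>p\<close> precedes
      \<open>p'\<close>, then \<open>g p = 0\<close>, a contradiction. Otherwise
      \<open>p' = p\<close>.\<close>
    show "0 \<le> - g p'"
      using p p' assms(1,2) by (smt (verit) total_on_def)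
  qed
qed

text \<open>The nonnegative part of a lexicographically ordered abelian group. Functions vanish off
  \<open>I\<close> because \<open>R\<close> is only required to be total on
  \<open>I\<close>.\<close>

definition lex_monoid :: "'i set \<Rightarrow> 'i rel \<Rightarrow> ('i \<Rightarrow> int) ordered_monoid" where
  "lex_monoid I R =
    \<lparr>carrier = {g. (\<forall>p. p \<notin> I \<longrightarrow> g p = 0) \<and> lex_nonneg R g},
     mult = (\<lambda>g h p. g p + h p), one = (\<lambda>_. 0),
     leq = {(g, h). (\<forall>p. p \<notin> I \<longrightarrow> g p = 0 \<and> h p = 0) \<and> lex_nonneg R g \<and> lex_nonneg R h \<and>
       lex_nonneg R (\<lambda>p. h p - g p)}\<rparr>"

lemma pos_tot_ord_monoid_lex_monoid:
  assumes "wf R" "trans R" "total_on I R" "I \<noteq> {}"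
  shows "pos_tot_ord_monoid (lex_monoid I R)"
proof
  let ?S = "lex_monoid I R"
  note add = lex_nonneg_add[OF assms(1,2)]
  note zero = lex_nonneg_if_nonneg[of "\<lambda>_. 0" R, simplified]
  show "x \<otimes>\<^bsub>?S\<^esub> y \<in> carrier ?S" if "x \<in> carrier ?S" "y \<in> carrier ?S" for x y
    using that add by (auto simp: lex_monoid_def)
  show "x \<otimes>\<^bsub>?S\<^esub> y \<otimes>\<^bsub>?S\<^esub> z = x \<otimes>\<^bsub>?S\<^esub> (y \<otimes>\<^bsub>?S\<^esub> z)" for x y z
    by (simp add: lex_monoid_def add.assoc)
  show "\<one>\<^bsub>?S\<^esub> \<in> carrier ?S"
    using zero by (simp add: lex_monoid_def)
  show "\<one>\<^bsub>?S\<^esub> \<otimes>\<^bsub>?S\<^esub> x = x" "x \<otimes>\<^bsub>?S\<^esub> \<one>\<^bsub>?S\<^esub> = x" for x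
    by (simp_all add: lex_monoid_def)
  show "linear_order_on (carrier ?S) (leq ?S)"
    unfolding linear_order_on_def partial_order_on_def preorder_on_def
  proof (intro conjI)
    show "leq ?S \<subseteq> carrier ?S \<times> carrier ?S" "refl_on (carrier ?S) (leq ?S)"
      using zero by (auto simp: refl_on_def lex_monoid_def)
    show "trans (leq ?S)"
    proof (rule transI)
      fix x y z assume *: "(x, y) \<in> leq ?S" "(y, z) \<in> leq ?S"
      then have "lex_nonneg R (\<lambda>p. (y p - x p) + (z p - y p))"
        by (intro add) (auto simp: lex_monoid_def)
      with * show "(x, z) \<in> leq ?S"
        by (auto simp: lex_monoid_def)
    qed
    show "antisym (leq ?S)"
    proof (rule antisymI)
      fix x y assume *: "(x, y) \<in> leq ?S" "(y, x) \<in> leq ?S"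
      have "y p - x p = 0" for p
        by (rule lex_nonneg_antisym[OF assms(1), of "\<lambda>p. y p - x p"])
          (use * in \<open>auto simp: lex_monoid_def\<close>)
      then show "x = y" by (simp add: fun_eq_iff)
    qed
    show "total_on (carrier ?S) (leq ?S)"
    proof (rule total_onI)
      fix x y assume *: "x \<in> carrier ?S" "y \<in> carrier ?S"
      show "(x, y) \<in> leq ?S \<or> (y, x) \<in> leq ?S"
        using lex_nonneg_total[OF assms(3), of "\<lambda>p. y p - x p"] *
        by (auto simp: lex_monoid_def)
    qed
  qed
  show "(a \<otimes>\<^bsub>?S\<^esub> c, b \<otimes>\<^bsub>?S\<^esub> d) \<in> leq ?S"
    if *: "(a, b) \<in> leq ?S" "(c, d) \<in> leq ?S" for a b c d
  proof -
    have "lex_nonneg R (\<lambda>p. (b p - a p) + (d p - c p))"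
      using * by (intro add) (auto simp: lex_monoid_def)
    moreover have "(\<lambda>p. (b p - a p) + (d p - c p)) = (\<lambda>p. (b p + d p) - (a p + c p))"
      by (simp add: fun_eq_iff)
    ultimately show ?thesis
      using * add by (auto simp: lex_monoid_def)
  qed
  show "(\<one>\<^bsub>?S\<^esub>, a) \<in> leq ?S" if "a \<in> carrier ?S" for a
    using that zero by (auto simp: lex_monoid_def)
  have "(\<lambda>p. of_bool (p \<in> I)) \<in> carrier ?S"
    by (auto simp: lex_monoid_def intro!: lex_nonneg_if_nonneg)
  moreover have "(\<lambda>p. of_bool (p \<in> I)) \<noteq> \<one>\<^bsub>?S\<^esub>"
    using \<open>I \<noteq> {}\<close> by (auto simp: fun_eq_iff lex_monoid_def)
  ultimately show "carrier ?S \<noteq> {\<one>\<^bsub>?S\<^esub>}"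
    by blast
qed

section \<open>Ultrafilters\<close>

text \<open>The last clause combines upward closure with primeness.\<close>

definition ultrafilter :: "'a set set \<Rightarrow> bool" where
  "ultrafilter p \<longleftrightarrow> {} \<notin> p \<and> UNIV \<in> p \<and> (\<forall>A B. A \<in> p \<longrightarrow> B \<in> p \<longrightarrow> A \<inter> B \<in> p) \<and>
    (\<forall>A B. A \<union> B \<in> p \<longleftrightarrow> A \<in> p \<or> B \<in> p)"

lemma ultrafilter_mono: "ultrafilter p \<Longrightarrow> A \<in> p \<Longrightarrow> A \<subseteq> B \<Longrightarrow> B \<in> p"
  by (metis ultrafilter_def sup.absorb2)

definition set_ideal :: "'a set set \<Rightarrow> bool" where
  "set_ideal J \<longleftrightarrow> {} \<in> J \<and> UNIV \<notin> J \<and> (\<forall>A\<in>J. \<forall>B\<in>J. A \<union> B \<in> J) \<and> (\<forall>A\<in>J. \<forall>B\<subseteq>A. B \<in> J)"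

text \<open>Zorn's lemma yields a maximal proper ideal \<open>M\<close> above \<open>J\<close>; the
  family \<open>- M\<close> of all sets outside \<open>M\<close> is the ultrafilter.\<close>

lemma ultrafilter_avoiding_ideal:
  assumes J: "set_ideal J"
  obtains p where "ultrafilter p" "p \<inter> J = {}"
proof -
  let ?\<J> = "{K. set_ideal K \<and> J \<subseteq> K}"
  have "\<exists>M\<in>?\<J>. \<forall>K\<in>?\<J>. M \<subseteq> K \<longrightarrow> K = M"
  proof (rule subset_Zorn_nonempty)
    show "?\<J> \<noteq> {}" using J by auto
    fix C assume C: "C \<noteq> {}" "subset.chain ?\<J> C"
    have ideals: "K \<in> C \<Longrightarrow> set_ideal K \<and> J \<subseteq> K" for K
      using C by (auto simp: subset_chain_def)
    have directed: "\<exists>K\<in>C. A \<in> K \<and> B \<in> K" if AB: "A \<in> \<Union>C" "B \<in> \<Union>C" for A B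
    proof -
      obtain K K' where K: "K \<in> C" "A \<in> K" "K' \<in> C" "B \<in> K'"
        using AB by blast
      then have "K \<subseteq> K' \<or> K' \<subseteq> K"
        using C(2) by (auto simp: subset_chain_def)
      with K show ?thesis by blast
    qed
    have "set_ideal (\<Union>C)"
      unfolding set_ideal_def
    proof (intro conjI ballI allI impI)
      show "{} \<in> \<Union>C" "UNIV \<notin> \<Union>C"
        using ideals C(1) by (auto simp: set_ideal_def)
      show "A \<union> B \<in> \<Union>C" if "A \<in> \<Union>C" "B \<in> \<Union>C" for A B
        using directed[OF that] ideals unfolding set_ideal_def by blast
      show "B \<in> \<Union>C" if A: "A \<in> \<Union>C" and B: "B \<subseteq> A" for A B
      proof -
        obtain K where "K \<in> C" "A \<in> K" using A by blast
        with B show ?thesis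
          using ideals[of K] unfolding set_ideal_def by blast
      qed
    qed
    then show "\<Union>C \<in> ?\<J>"
      using ideals C(1) by blast
  qed
  then obtain M where M: "set_ideal M" "J \<subseteq> M"
    and max: "\<And>K. set_ideal K \<Longrightarrow> M \<subseteq> K \<Longrightarrow> K = M"
    by (auto dest: order.trans)
  have compl: "A \<in> M \<or> - A \<in> M" for A
  proof (rule ccontr)
    assume *: "\<not> (A \<in> M \<or> - A \<in> M)"
    \<comment> \<open>The ideal generated by \<open>M\<close> and \<open>A\<close>. It is proper
      because \<open>- A\<close> is not in \<open>M\<close>, so it contradicts maximality.\<close>
    let ?K = "{B. B - A \<in> M}"
    have "set_ideal ?K"
      unfolding set_ideal_def
    proof (intro conjI ballI allI impI)
      show "{} \<in> ?K" "UNIV \<notin> ?K"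
        using M * by (auto simp: set_ideal_def Compl_eq_Diff_UNIV)
      show "B \<union> B' \<in> ?K" if "B \<in> ?K" "B' \<in> ?K" for B B'
        using that M by (auto simp: set_ideal_def Un_Diff)
      show "B' \<in> ?K" if "B \<in> ?K" "B' \<subseteq> B" for B B'
        using that M unfolding set_ideal_def by (metis Diff_mono mem_Collect_eq order_refl)
    qed
    moreover have "M \<subseteq> ?K"
      using M unfolding set_ideal_def by blast
    moreover have "A \<in> ?K"
      using M by (simp add: set_ideal_def)
    ultimately show False
      using max * by blast
  qed
  have Un: "A \<union> B \<in> M \<longleftrightarrow> A \<in> M \<and> B \<in> M" for A B
    using M(1) unfolding set_ideal_def by (meson sup_ge1 sup_ge2)
  show thesis
  proof
    show "ultrafilter (- M)"
      unfolding ultrafilter_def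
    proof (intro conjI allI impI)
      show "{} \<notin> - M" "UNIV \<in> - M"
        using M by (auto simp: set_ideal_def)
      show "A \<inter> B \<in> - M" if "A \<in> - M" "B \<in> - M" for A B
      proof
        assume "A \<inter> B \<in> M"
        moreover have "- A \<in> M" "- B \<in> M"
          using that compl by auto
        ultimately have "A \<inter> B \<union> (- A \<union> - B) \<in> M"
          using Un by blast
        moreover have "A \<inter> B \<union> (- A \<union> - B) = UNIV" by auto
        ultimately show False
          using M by (simp add: set_ideal_def)
      qed
      show "A \<union> B \<in> - M \<longleftrightarrow> A \<in> - M \<or> B \<in> - M" for A B
        using Un by auto
    qed
    show "- M \<inter> J = {}" using M by auto
  qed
qed

section \<open>Cones\<close>

text \<open>The assumption \<open>short_seqs\<close> bounds the number of cones by
  \<open>lam\<close>, and \<open>less_cexp\<close> says that the space has more than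
  \<open>lam\<close> points.\<close>

locale generalized_baire =
  fixes \<kappa> :: "'k rel" and lam :: "'l rel"
  assumes \<kappa>: "Cinfinite \<kappa>" and lam: "Cinfinite lam"
    and short_seqs: "|short_seqs \<kappa> lam| \<le>o lam"
    and less_cexp: "lam <o lam ^c \<kappa>"
begin

abbreviation X where "X \<equiv> long_seqs \<kappa> lam"
abbreviation T where "T \<equiv> bounded_topology \<kappa> lam"
abbreviation small where "small A \<equiv> |A| \<le>o lam"

text \<open>Cones are given by a point and a level instead of a partial map; by
  \<open>cone_eq_nbhd\<close> any point of a nonempty cone can serve as \<open>x\<close>.\<close>

definition nbhd :: "('k \<Rightarrow> 'l) \<Rightarrow> 'k \<Rightarrow> ('k \<Rightarrow> 'l) set" where
  "nbhd x \<xi> = {y \<in> X. \<forall>\<beta>\<in>underS \<kappa> \<xi>. y \<beta> = x \<beta>}"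

lemma order_\<kappa>: "trans \<kappa>" "antisym \<kappa>" "wf (\<kappa> - Id)" "total_on (Field \<kappa>) \<kappa>" "refl_on (Field \<kappa>) \<kappa>"
  using \<kappa> by (auto simp: card_order_on_def order_on_defs)

lemma infinite_Field: "infinite (Field \<kappa>)" "infinite (Field lam)"
  using \<kappa> lam by (auto simp: cinfinite_def)

lemma ex_greater: "\<xi> \<in> Field \<kappa> \<Longrightarrow> \<exists>\<eta>\<in>Field \<kappa>. \<xi> \<in> underS \<kappa> \<eta>"
  using infinite_Card_order_limit[of \<kappa> \<xi>] \<kappa> infinite_Field by (auto simp: underS_def)

lemma nbhd_subset: "nbhd x \<xi> \<subseteq> X"
  by (auto simp: nbhd_def)

lemma mem_nbhd: "x \<in> X \<Longrightarrow> x \<in> nbhd x \<xi>"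
  by (simp add: nbhd_def)

lemma nbhd_antimono: "(\<xi>, \<eta>) \<in> \<kappa> \<Longrightarrow> nbhd x \<eta> \<subseteq> nbhd x \<xi>"
  using underS_incr[OF order_\<kappa>(1,2), of \<xi> \<eta>] by (auto simp: nbhd_def)

lemma cone_eq_nbhd:
  assumes "dom s = underS \<kappa> \<xi>" "x \<in> cone \<kappa> lam s"
  shows "cone \<kappa> lam s = nbhd x \<xi>"
proof -
  have "s \<beta> = Some (x \<beta>)" if "\<beta> \<in> underS \<kappa> \<xi>" for \<beta>
    using assms that by (auto simp: cone_def map_le_def)
  then show ?thesis
    using assms(1) by (auto simp: cone_def nbhd_def map_le_def)
qed

lemma nbhd_is_cone:
  assumes "x \<in> X" "\<xi> \<in> Field \<kappa>"
  obtains s where "s \<in> short_seqs \<kappa> lam" "dom s = underS \<kappa> \<xi>" "cone \<kappa> lam s = nbhd x \<xi>"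
proof
  let ?s = "(Some \<circ> x) |` underS \<kappa> \<xi>"
  show dom: "dom ?s = underS \<kappa> \<xi>" by auto
  have "x \<beta> \<in> Field lam" if "\<beta> \<in> underS \<kappa> \<xi>" for \<beta>
    using that assms(1) underS_Field[of _ \<kappa> \<xi>] by (auto simp: long_seqs_def Func_def)
  then have "ran ?s \<subseteq> Field lam"
    by (auto simp: ran_def restrict_map_def)
  then show "?s \<in> short_seqs \<kappa> lam"
    using dom assms(2) unfolding short_seqs_def by blast
  show "cone \<kappa> lam ?s = nbhd x \<xi>"
    by (rule cone_eq_nbhd[OF dom]) (use assms(1) in \<open>auto simp: cone_def map_le_def\<close>)
qed

lemma openin_nbhd: "x \<in> X \<Longrightarrow> \<xi> \<in> Field \<kappa> \<Longrightarrow> openin T (nbhd x \<xi>)"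
  unfolding bounded_topology_def by (metis nbhd_is_cone imageI topology_generated_by_Basis)

lemma nbhd_subset_openin:
  assumes "openin T U" "x \<in> U"
  shows "\<exists>\<xi>\<in>Field \<kappa>. nbhd x \<xi> \<subseteq> U"
proof -
  have "generate_topology_on (cone \<kappa> lam ` short_seqs \<kappa> lam) U"
    using assms(1) by (simp add: bounded_topology_def openin_topology_generated_by)
  then show ?thesis
    using assms(2)
  proof (induction rule: generate_topology_on.induct)
    case (Int U V)
    then obtain \<xi> \<eta> where *: "\<xi> \<in> Field \<kappa>" "nbhd x \<xi> \<subseteq> U" "\<eta> \<in> Field \<kappa>" "nbhd x \<eta> \<subseteq> V"
      by blast
    \<comment> \<open>Cones around \<open>x\<close> are nested, so the larger of the two levels
      serves for both sets.\<close>
    then have "(\<xi>, \<eta>) \<in> \<kappa> \<or> (\<eta>, \<xi>) \<in> \<kappa>"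
      using order_\<kappa>(4,5) by (metis refl_onD total_on_def)
    then show ?case
      using * nbhd_antimono[of \<xi> \<eta> x] nbhd_antimono[of \<eta> \<xi> x] by blast
  next
    case (UN K)
    then show ?case by blast
  next
    case (Basis C)
    then obtain s \<xi> where "C = cone \<kappa> lam s" "\<xi> \<in> Field \<kappa>" "dom s = underS \<kappa> \<xi>"
      by (auto simp: short_seqs_def)
    with Basis.prems show ?case
      using cone_eq_nbhd by blast
  qed simp
qed

lemma topspace_T: "topspace T = X"
proof
  show "topspace T \<subseteq> X"
    by (auto simp: bounded_topology_def cone_def)
  obtain \<xi> where "\<xi> \<in> Field \<kappa>" using infinite_Field(1) by fastforce
  then show "X \<subseteq> topspace T"
    using openin_nbhd openin_subset mem_nbhd by blast
qed

section \<open>Small sets and the size of cones\<close>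

lemma small_subset: "small B \<Longrightarrow> A \<subseteq> B \<Longrightarrow> small A"
  using card_of_mono1 ordLeq_transitive by blast

lemma small_Un: "small A \<Longrightarrow> small B \<Longrightarrow> small (A \<union> B)"
  using card_of_Un_ordLeq_infinite_Field[of lam A B] lam infinite_Field by auto

lemma small_UN: "small I \<Longrightarrow> (\<And>i. i \<in> I \<Longrightarrow> small (A i)) \<Longrightarrow> small (\<Union>i\<in>I. A i)"
  using card_of_UNION_ordLeq_infinite_Field[of lam I A] lam infinite_Field by auto

lemma finite_imp_small: "finite A \<Longrightarrow> small A"
  by (rule ordLess_imp_ordLeq, rule finite_ordLess_infinite)
    (use lam infinite_Field(2) in \<open>simp_all add: card_order_on_def card_of_Well_order Field_card_of card_of_well_order_on\<close>)

text \<open>All cones of one level are equinumerous, and at most \<open>lam\<close> of them cover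
  the space. If one were small, the whole space would be small, against
  \<open>less_cexp\<close>.\<close>

lemma not_small_nbhd:
  assumes "x \<in> X" "\<xi> \<in> Field \<kappa>"
  shows "\<not> small (nbhd x \<xi>)"
proof
  assume small: "small (nbhd x \<xi>)"
  have small_all: "small (nbhd y \<xi>)" if "y \<in> X" for y
  proof -
    \<comment> \<open>Replacing the initial segment by that of \<open>x\<close> is injective, since
      all members of \<open>nbhd y \<xi>\<close> agree below \<xi>.\<close>
    let ?f = "\<lambda>z \<beta>. if \<beta> \<in> underS \<kappa> \<xi> then x \<beta> else z \<beta>"
    have "|nbhd y \<xi>| \<le>o |nbhd x \<xi>|"
    proof (rule card_of_ordLeqI)
      show "inj_on ?f (nbhd y \<xi>)"
      proof (rule inj_onI, rule ext)
        fix u v \<beta> assume *: "u \<in> nbhd y \<xi>" "v \<in> nbhd y \<xi>" "?f u = ?f v"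
        show "u \<beta> = v \<beta>"
          using * fun_cong[OF *(3), of \<beta>] by (cases "\<beta> \<in> underS \<kappa> \<xi>") (auto simp: nbhd_def)
      qed
      show "?f z \<in> nbhd x \<xi>" if "z \<in> nbhd y \<xi>" for z
        using that assms(1) underS_Field[of _ \<kappa> \<xi>] by (auto simp: nbhd_def long_seqs_def Func_def)
    qed
    with small show ?thesis using ordLeq_transitive by blast
  qed
  have "small (if dom s = underS \<kappa> \<xi> then cone \<kappa> lam s else {})" for s
  proof (cases "dom s = underS \<kappa> \<xi> \<and> cone \<kappa> lam s \<noteq> {}")
    case True
    then obtain y where y: "y \<in> cone \<kappa> lam s" by blast
    then have "y \<in> X" by (simp add: cone_def)
    then show ?thesis
      using True small_all cone_eq_nbhd[OF _ y] by simp
  next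
    case False
    then have "(if dom s = underS \<kappa> \<xi> then cone \<kappa> lam s else {}) = {}" by auto
    then show ?thesis by (simp add: finite_imp_small)
  qed
  then have "small (\<Union>s\<in>short_seqs \<kappa> lam. if dom s = underS \<kappa> \<xi> then cone \<kappa> lam s else {})"
    using short_seqs by (intro small_UN)
  moreover have "X \<subseteq> (\<Union>s\<in>short_seqs \<kappa> lam. if dom s = underS \<kappa> \<xi> then cone \<kappa> lam s else {})"
  proof
    fix y assume "y \<in> X"
    then obtain s where "s \<in> short_seqs \<kappa> lam" "dom s = underS \<kappa> \<xi>" "cone \<kappa> lam s = nbhd y \<xi>"
      using nbhd_is_cone assms(2) by blast
    with \<open>y \<in> X\<close> show "y \<in> (\<Union>s\<in>short_seqs \<kappa> lam. if dom s = underS \<kappa> \<xi> then cone \<kappa> lam s else {})"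
      using mem_nbhd by (intro UN_I[of s]) auto
  qed
  ultimately have "small X" by (rule small_subset)
  then show False
    using less_cexp not_ordLess_ordLeq by (auto simp: cexp_def long_seqs_def)
qed

section \<open>The index set\<close>

text \<open>Nowhere density modulo small sets. Points outside \<open>X\<close> do not count, as
  cones lie in \<open>X\<close>.\<close>

definition thin :: "('k \<Rightarrow> 'l) set \<Rightarrow> bool" where
  "thin A \<longleftrightarrow> (\<forall>x\<in>X. \<forall>\<xi>\<in>Field \<kappa>. \<exists>y\<in>X. \<exists>\<eta>\<in>Field \<kappa>.
    nbhd y \<eta> \<subseteq> nbhd x \<xi> \<and> small (nbhd y \<eta> \<inter> A))"

lemma thin_subset:
  assumes "thin B" "A \<inter> X \<subseteq> B"
  shows "thin A"
  unfolding thin_def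
proof (intro ballI)
  fix x \<xi> assume "x \<in> X" "\<xi> \<in> Field \<kappa>"
  then obtain y \<eta> where y: "y \<in> X" "\<eta> \<in> Field \<kappa>" "nbhd y \<eta> \<subseteq> nbhd x \<xi>" "small (nbhd y \<eta> \<inter> B)"
    using assms(1) unfolding thin_def by blast
  have "small (nbhd y \<eta> \<inter> A)"
    by (rule small_subset[OF y(4)]) (use assms(2) nbhd_subset in blast)
  with y show "\<exists>y\<in>X. \<exists>\<eta>\<in>Field \<kappa>. nbhd y \<eta> \<subseteq> nbhd x \<xi> \<and> small (nbhd y \<eta> \<inter> A)"
    by blast
qed

lemma thin_if_small: "small A \<Longrightarrow> thin A"
  unfolding thin_def by (blast intro: small_subset)

text \<open>Pass to a subcone for \<open>A\<close>, and inside it to a further subcone for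
  \<open>B\<close>.\<close>

lemma thin_Un:
  assumes "thin A" "thin B"
  shows "thin (A \<union> B)"
  unfolding thin_def
proof (intro ballI)
  fix x \<xi> assume "x \<in> X" "\<xi> \<in> Field \<kappa>"
  then obtain y \<eta> where y: "y \<in> X" "\<eta> \<in> Field \<kappa>" "nbhd y \<eta> \<subseteq> nbhd x \<xi>" "small (nbhd y \<eta> \<inter> A)"
    using assms(1) unfolding thin_def by blast
  then obtain z \<zeta> where z: "z \<in> X" "\<zeta> \<in> Field \<kappa>" "nbhd z \<zeta> \<subseteq> nbhd y \<eta>" "small (nbhd z \<zeta> \<inter> B)"
    using assms(2) unfolding thin_def by blast
  have "small (nbhd z \<zeta> \<inter> A)"
    using small_subset[OF y(4)] z(3) by blast
  then have "small (nbhd z \<zeta> \<inter> (A \<union> B))"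
    using small_Un[OF _ z(4)] by (simp add: Int_Un_distrib)
  then show "\<exists>z\<in>X. \<exists>\<zeta>\<in>Field \<kappa>. nbhd z \<zeta> \<subseteq> nbhd x \<xi> \<and> small (nbhd z \<zeta> \<inter> (A \<union> B))"
    using y z by blast
qed

text \<open>A subcone of the given cone meets it in the whole subcone, which is not small.\<close>

lemma not_thin_nbhd:
  assumes "x \<in> X" "\<xi> \<in> Field \<kappa>"
  shows "\<not> thin (nbhd x \<xi>)"
proof
  assume "thin (nbhd x \<xi>)"
  then obtain y \<eta> where "y \<in> X" "\<eta> \<in> Field \<kappa>" "nbhd y \<eta> \<subseteq> nbhd x \<xi>"
    and "small (nbhd y \<eta> \<inter> nbhd x \<xi>)"
    using assms unfolding thin_def by blast
  then show False
    using not_small_nbhd by (simp add: Int_absorb2)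
qed

text \<open>The last clause excludes ultrafilters that contain cones of every level; on these the
  measures of the cones around a point might not decrease to 0.\<close>

definition idx :: "('k \<Rightarrow> 'l) set set set" where
  "idx = {p. ultrafilter p \<and> (\<forall>A. thin A \<longrightarrow> A \<notin> p) \<and> (\<exists>\<xi>\<in>Field \<kappa>. \<forall>x\<in>X. nbhd x \<xi> \<notin> p)}"

text \<open>This makes every cone have positive measure. The ultrafilter avoids all thin sets, the
  complement of the cone, and all cones of one higher level. These generate a proper ideal because
  the cone splits into infinitely many cones of the next level.\<close>

lemma ex_idx:
  assumes x: "x \<in> X" and \<xi>: "\<xi> \<in> Field \<kappa>"
  shows "\<exists>p\<in>idx. nbhd x \<xi> \<in> p"
proof -
  \<comment> \<open>Cones of level \<eta> fix the coordinate \<xi>, on which the members of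
    \<open>nbhd x \<xi>\<close> are still free.\<close>
  obtain \<eta> where \<eta>: "\<eta> \<in> Field \<kappa>" "\<xi> \<in> underS \<kappa> \<eta>"
    using ex_greater[OF \<xi>] by blast
  let ?R = "\<lambda>A Y. A \<inter> nbhd x \<xi> - (\<Union>y\<in>Y. nbhd y \<eta>)"
  \<comment> \<open>The ideal generated by the thin sets, \<open>- nbhd x \<xi>\<close> and the
    cones of level \<eta>.\<close>
  let ?J = "{A. \<exists>Y. finite Y \<and> Y \<subseteq> X \<and> thin (?R A Y)}"
  have thin_empty: "thin {}" by (simp add: thin_if_small finite_imp_small)
  have "set_ideal ?J"
    unfolding set_ideal_def
  proof (intro conjI ballI allI impI)
    show "{} \<in> ?J" using thin_empty by (auto intro: exI[of _ "{}"])
    show "UNIV \<notin> ?J"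
    proof
      assume "UNIV \<in> ?J"
      then obtain Y where Y: "finite Y" "Y \<subseteq> X" "thin (?R UNIV Y)" by blast
      \<comment> \<open>Finitely many cones of level \<eta> use finitely many values at \<xi>. A
        fresh value \<open>c\<close> gives a cone inside \<open>nbhd x \<xi>\<close> that is
        disjoint from all of them and not thin.\<close>
      obtain c where c: "c \<in> Field lam" "c \<notin> (\<lambda>y. y \<xi>) ` Y"
        using infinite_Field(2) Y(1) by (meson finite_imageI finite_subset subsetI)
      let ?z = "x(\<xi> := c)"
      have z: "?z \<in> X"
        using x \<xi> c(1) by (auto simp: long_seqs_def Func_def)
      have "nbhd ?z \<eta> \<subseteq> nbhd ?z \<xi>"
        using \<eta>(2) by (intro nbhd_antimono) (simp add: underS_def)
      also have "\<dots> = nbhd x \<xi>"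
        by (auto simp: nbhd_def underS_def)
      finally have "nbhd ?z \<eta> \<subseteq> nbhd x \<xi>" .
      have "w \<notin> nbhd y \<eta>" if "w \<in> nbhd ?z \<eta>" "y \<in> Y" for w y
      proof
        assume "w \<in> nbhd y \<eta>"
        then have "c = y \<xi>"
          using that(1) \<eta>(2) by (auto simp: nbhd_def)
        with c(2) that(2) show False by blast
      qed
      with \<open>nbhd ?z \<eta> \<subseteq> nbhd x \<xi>\<close> have "nbhd ?z \<eta> \<inter> X \<subseteq> ?R UNIV Y"
        by (simp add: subset_iff)
      then have "thin (nbhd ?z \<eta>)"
        by (rule thin_subset[OF Y(3)])
      then show False
        using not_thin_nbhd z \<eta>(1) by blast
    qed
    show "A \<union> B \<in> ?J" if "A \<in> ?J" "B \<in> ?J" for A B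
    proof -
      obtain Y Z where Y: "finite Y" "Y \<subseteq> X" "thin (?R A Y)"
        and Z: "finite Z" "Z \<subseteq> X" "thin (?R B Z)"
        using \<open>A \<in> ?J\<close> \<open>B \<in> ?J\<close> by blast
      have "thin (?R (A \<union> B) (Y \<union> Z))"
        by (rule thin_subset[OF thin_Un[OF Y(3) Z(3)]]) blast
      moreover have "finite (Y \<union> Z)" "Y \<union> Z \<subseteq> X"
        using Y(1,2) Z(1,2) by auto
      ultimately show ?thesis by blast
    qed
    show "B \<in> ?J" if "A \<in> ?J" and B: "B \<subseteq> A" for A B
    proof -
      obtain Y where Y: "finite Y" "Y \<subseteq> X" "thin (?R A Y)"
        using \<open>A \<in> ?J\<close> by blast
      have "thin (?R B Y)"
        by (rule thin_subset[OF Y(3)]) (use B in blast)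
      then show ?thesis using Y by blast
    qed
  qed
  then obtain p where p: "ultrafilter p" "p \<inter> ?J = {}"
    using ultrafilter_avoiding_ideal by blast
  have "A \<in> ?J" if "thin A" for A
  proof -
    have "thin (?R A {})"
      by (rule thin_subset[OF that]) blast
    then show ?thesis by blast
  qed
  moreover have "nbhd y \<eta> \<in> ?J" if "y \<in> X" for y
  proof -
    have "?R (nbhd y \<eta>) {y} = {}" by blast
    then have "thin (?R (nbhd y \<eta>) {y})" using thin_empty by metis
    then show ?thesis using that by blast
  qed
  ultimately have "p \<in> idx"
    using p \<eta>(1) unfolding idx_def by blast
  have "?R (- nbhd x \<xi>) {} = {}" by blast
  then have "thin (?R (- nbhd x \<xi>) {})" using thin_empty by metis
  then have "- nbhd x \<xi> \<notin> p" using p(2) by blast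
  then have "nbhd x \<xi> \<in> p"
    using p(1) unfolding ultrafilter_def by (metis Compl_partition)
  with \<open>p \<in> idx\<close> show ?thesis by blast
qed

lemma idx_nonempty: "idx \<noteq> {}"
proof -
  obtain c where "c \<in> Field lam" using infinite_Field(2) by fastforce
  then have "(\<lambda>\<beta>. if \<beta> \<in> Field \<kappa> then c else undefined) \<in> X"
    by (auto simp: long_seqs_def Func_def)
  moreover obtain \<xi> where "\<xi> \<in> Field \<kappa>" using infinite_Field(1) by fastforce
  ultimately show ?thesis using ex_idx by blast
qed

section \<open>The well-order of the index set\<close>

text \<open>Some level witnessing the last clause of \<open>idx\<close>, not necessarily the
  least.\<close>

definition rank :: "('k \<Rightarrow> 'l) set set \<Rightarrow> 'k" where
  "rank p = (SOME \<xi>. \<xi> \<in> Field \<kappa> \<and> (\<forall>x\<in>X. nbhd x \<xi> \<notin> p))"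

lemma rank:
  assumes "p \<in> idx"
  shows "rank p \<in> Field \<kappa>" "x \<in> X \<Longrightarrow> nbhd x (rank p) \<notin> p"
proof -
  have "\<exists>\<xi>. \<xi> \<in> Field \<kappa> \<and> (\<forall>x\<in>X. nbhd x \<xi> \<notin> p)"
    using assms by (auto simp: idx_def)
  from someI_ex[OF this] show "rank p \<in> Field \<kappa>" "x \<in> X \<Longrightarrow> nbhd x (rank p) \<notin> p"
    by (auto simp: rank_def)
qed

text \<open>
  Ordering by rank first ensures that, by \<open>nbhd_notin_below\<close>, a single cone around \<open>x\<close> is null for all
  indices up to \<open>p\<close>.
\<close>

definition idx_less :: "('k \<Rightarrow> 'l) set set rel" where
  "idx_less = inv_image ((\<kappa> - Id) <*lex*> ( |UNIV| - Id)) (\<lambda>p. (rank p, p))"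

text \<open>Ties in rank are broken by a well-order of all families of sets. Totality is stated on
  \<open>idx\<close> because there the ranks lie in \<open>Field \<kappa>\<close>.\<close>

lemma idx_less: "wf idx_less" "trans idx_less" "total_on idx idx_less"
proof -
  let ?W = "|UNIV :: ('k \<Rightarrow> 'l) set set set|"
  have W: "trans ?W" "antisym ?W" "wf (?W - Id)" "total_on UNIV ?W"
    using card_of_well_order_on[of "UNIV :: ('k \<Rightarrow> 'l) set set set"] by (auto simp: order_on_defs)
  show "wf idx_less"
    unfolding idx_less_def using order_\<kappa> W by (intro wf_inv_image wf_lex_prod)
  show "trans idx_less"
    unfolding idx_less_def using order_\<kappa> W by (intro trans_inv_image trans_lex_prod trans_diff_Id)
  show "total_on idx idx_less"
  proof (rule total_onI)
    fix p q assume "p \<in> idx" "q \<in> idx" "p \<noteq> q"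
    moreover from this have "rank p \<noteq> rank q \<Longrightarrow> (rank p, rank q) \<in> \<kappa> \<or> (rank q, rank p) \<in> \<kappa>"
      using order_\<kappa>(4) rank(1) by (simp add: total_on_def)
    moreover have "(p, q) \<in> ?W \<or> (q, p) \<in> ?W"
      using \<open>p \<noteq> q\<close> W(4) by (simp add: total_on_def)
    ultimately show "(p, q) \<in> idx_less \<or> (q, p) \<in> idx_less"
      by (cases "rank p = rank q") (auto simp only: idx_less_def in_inv_image in_lex_prod Diff_iff pair_in_Id_conv)
  qed
qed

text \<open>The rank of \<open>q\<close> is at most that of \<open>p\<close>, so the cone of level
  \<open>rank p\<close> lies in the cone of level \<open>rank q\<close>, which \<open>q\<close> does
  not contain.\<close>

lemma nbhd_notin_below:
  assumes "x \<in> X" "p \<in> idx" "q \<in> idx" "(q, p) \<in> idx_less \<or> q = p"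
  shows "nbhd x (rank p) \<notin> q"
proof
  assume *: "nbhd x (rank p) \<in> q"
  have "(rank q, rank p) \<in> \<kappa>"
    using assms(4) rank(1)[OF assms(2)] order_\<kappa>(5) by (auto simp: idx_less_def refl_on_def)
  then have "nbhd x (rank q) \<in> q"
    using * assms(3) nbhd_antimono[of "rank q" "rank p" x] ultrafilter_mono
    unfolding idx_def by blast
  then show False using rank(2) assms by blast
qed

section \<open>The measure\<close>

definition measurables :: "('k \<Rightarrow> 'l) set set" where
  "measurables = {A. A \<subseteq> X \<and> small (A - T interior_of A)}"

abbreviation S :: "(('k \<Rightarrow> 'l) set set \<Rightarrow> int) ordered_monoid" where
  "S \<equiv> lex_monoid idx idx_less"

text \<open>The conjunct \<open>p \<in> idx\<close> makes the function vanish off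
  \<open>idx\<close>, as the carrier of \<open>S\<close> demands.\<close>

definition ind :: "('k \<Rightarrow> 'l) set \<Rightarrow> ('k \<Rightarrow> 'l) set set \<Rightarrow> int" where
  "ind A = (\<lambda>p. of_bool (p \<in> idx \<and> A \<in> p))"

definition \<mu> :: "('k \<Rightarrow> 'l) set \<rightharpoonup> (('k \<Rightarrow> 'l) set set \<Rightarrow> int)" where
  "\<mu> A = (if A \<in> measurables then Some (ind A) else None)"

lemma pos_tot_ord_monoid_S: "pos_tot_ord_monoid S"
  using pos_tot_ord_monoid_lex_monoid idx_less idx_nonempty .

text \<open>The interiors of the \<open>A i\<close> lie in the interior of the union, so what the
  union has outside its interior is covered by at most \<open>lam\<close> small sets.\<close>

lemma measurables_UN:
  assumes I: "small I" and A: "\<And>i. i \<in> I \<Longrightarrow> A i \<in> measurables"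
  shows "(\<Union>i\<in>I. A i) \<in> measurables"
proof -
  have "small (\<Union>i\<in>I. A i - T interior_of A i)"
    using A by (intro small_UN[OF I]) (simp add: measurables_def)
  moreover have "T interior_of A i \<subseteq> T interior_of (\<Union>i\<in>I. A i)" if "i \<in> I" for i
    using that by (intro interior_of_mono) blast
  then have "(\<Union>i\<in>I. A i) - T interior_of (\<Union>i\<in>I. A i) \<subseteq> (\<Union>i\<in>I. A i - T interior_of A i)"
    by blast
  ultimately have "small ((\<Union>i\<in>I. A i) - T interior_of (\<Union>i\<in>I. A i))"
    by (rule small_subset)
  moreover have "(\<Union>i\<in>I. A i) \<subseteq> X"
    using A by (auto simp: measurables_def)
  ultimately show ?thesis
    by (simp add: measurables_def)
qed

lemma measurables_openin: "openin T U \<Longrightarrow> U \<in> measurables"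
  using openin_subset[of T U] finite_imp_small[of "{}"]
  by (simp add: measurables_def interior_of_openin topspace_T)

lemma measurables_small: "small A \<Longrightarrow> A \<subseteq> X \<Longrightarrow> A \<in> measurables"
  using small_subset[of A] by (auto simp: measurables_def)

lemma weakly_measurable_space_measurables: "weakly_measurable_space lam T measurables"
  unfolding weakly_measurable_space_def
proof (intro conjI allI impI)
  show "measurables \<subseteq> Pow (topspace T)"
    by (auto simp: measurables_def topspace_T)
  show "\<Union>\<A> \<in> measurables" if "\<A> \<subseteq> measurables \<and> small \<A>" for \<A>
    using measurables_UN[of \<A> "\<lambda>A. A"] that by auto
qed (rule measurables_openin)

section \<open>Values of the measure and finite additivity\<close>

lemma idx_ultrafilter: "p \<in> idx \<Longrightarrow> ultrafilter p"
  by (simp add: idx_def)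

lemma idx_thin: "p \<in> idx \<Longrightarrow> thin A \<Longrightarrow> A \<notin> p"
  by (simp add: idx_def)

lemma X_in_idx: "p \<in> idx \<Longrightarrow> X \<in> p"
proof -
  assume p: "p \<in> idx"
  have "thin (- X)"
    by (rule thin_subset[of "{}"]) (auto simp: thin_if_small finite_imp_small)
  with p have "- X \<notin> p" by (rule idx_thin)
  moreover have "X \<union> - X \<in> p"
    using idx_ultrafilter[OF p] by (simp add: ultrafilter_def)
  ultimately show ?thesis
    using idx_ultrafilter[OF p] unfolding ultrafilter_def by blast
qed

lemma ind_carrier: "ind A \<in> carrier S"
  by (auto simp: lex_monoid_def ind_def intro!: lex_nonneg_if_nonneg)

lemma zero_carrier: "(\<lambda>_. 0) \<in> carrier S"
  by (auto simp: lex_monoid_def intro!: lex_nonneg_if_nonneg)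

lemma ind_thin: "thin A \<Longrightarrow> ind A = (\<lambda>_. 0)"
  using idx_thin by (auto simp: ind_def)

lemma ind_mono:
  assumes "A \<subseteq> B"
  shows "(ind A, ind B) \<in> leq S"
proof -
  have "ind A p \<le> ind B p" for p
    using assms ultrafilter_mono[OF idx_ultrafilter, of p A B] by (auto simp: ind_def)
  then show ?thesis
    using ind_carrier[of A] ind_carrier[of B]
    by (auto simp: lex_monoid_def intro!: lex_nonneg_if_nonneg)
qed

text \<open>An ultrafilter contains at most one of two disjoint sets, and contains their union iff
  it contains one of them.\<close>

lemma ind_Un_disjoint:
  assumes "A \<inter> B = {}"
  shows "ind (A \<union> B) p = ind A p + ind B p"
proof (cases "p \<in> idx")
  case True
  have "\<not> (A \<in> p \<and> B \<in> p)"
    using assms idx_ultrafilter[OF True] unfolding ultrafilter_def by metis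
  moreover have "A \<union> B \<in> p \<longleftrightarrow> A \<in> p \<or> B \<in> p"
    using idx_ultrafilter[OF True] unfolding ultrafilter_def by blast
  ultimately show ?thesis
    by (auto simp: ind_def)
qed (simp add: ind_def)

lemma ind_UN_disjoint:
  assumes "finite I" "disjoint_family_on F I"
  shows "ind (\<Union>i\<in>I. F i) p = (\<Sum>i\<in>I. ind (F i) p)"
  using assms
proof (induction I rule: finite_induct)
  case empty
  show ?case using ind_thin[of "{}"] by (simp add: thin_if_small finite_imp_small)
next
  case (insert i I)
  have "disjoint_family_on F I"
    using insert.prems by (rule disjoint_family_on_mono[OF subset_insertI])
  moreover have "F i \<inter> (\<Union>j\<in>I. F j) = {}"
    using insert.prems insert.hyps(2) by (auto simp: disjoint_family_on_def)
  ultimately show ?case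
    using insert.IH insert.hyps ind_Un_disjoint by simp
qed

text \<open>
  In contrast to thinness of \<open>A - B\<close>, the conclusion is preserved by unions of \<open>lam\<close> many sets: thin
  sets are not closed under such unions.
\<close>

lemma small_nbhd_Int_cong:
  assumes A: "A \<in> measurables" and B: "B \<in> measurables" and eq: "ind A = ind B"
    and x: "x \<in> X" "\<xi> \<in> Field \<kappa>" and small: "small (nbhd x \<xi> \<inter> B)"
  shows "small (nbhd x \<xi> \<inter> A)"
proof (rule ccontr)
  assume not_small: "\<not> small (nbhd x \<xi> \<inter> A)"
  \<comment> \<open>Only a small part of \<open>A\<close> lies outside its interior, so a trace of
    \<open>A\<close> that is not small must meet the interior.\<close>
  have "nbhd x \<xi> \<inter> T interior_of A \<noteq> {}"
  proof
    assume "nbhd x \<xi> \<inter> T interior_of A = {}"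
    then have "nbhd x \<xi> \<inter> A \<subseteq> A - T interior_of A" by blast
    moreover have "small (A - T interior_of A)"
      using A by (simp add: measurables_def)
    ultimately show False
      using not_small small_subset by blast
  qed
  then obtain y where y: "y \<in> nbhd x \<xi> \<inter> T interior_of A" by blast
  moreover have "openin T (nbhd x \<xi> \<inter> T interior_of A)"
    using x by (simp add: openin_nbhd openin_Int)
  ultimately obtain \<eta> where \<eta>: "\<eta> \<in> Field \<kappa>" "nbhd y \<eta> \<subseteq> nbhd x \<xi> \<inter> T interior_of A"
    using nbhd_subset_openin by blast
  have "y \<in> X"
    using y nbhd_subset by blast
  \<comment> \<open>This index contains a subcone of \<open>A\<close>, hence \<open>A\<close>, hence
    by \<open>eq\<close> also \<open>B\<close>, and so the small set
    \<open>nbhd y \<eta> \<inter> B\<close>, which is impossible.\<close>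
  then obtain p where p: "p \<in> idx" "nbhd y \<eta> \<in> p"
    using ex_idx \<eta>(1) by blast
  have "nbhd y \<eta> \<subseteq> A"
    using \<eta>(2) interior_of_subset[of T A] by blast
  then have "A \<in> p"
    using ultrafilter_mono[OF idx_ultrafilter] p by blast
  then have "B \<in> p"
    using fun_cong[OF eq, of p] p(1) by (simp add: ind_def)
  then have "nbhd y \<eta> \<inter> B \<in> p"
    using idx_ultrafilter p unfolding ultrafilter_def by blast
  moreover have "small (nbhd y \<eta> \<inter> B)"
    by (rule small_subset[OF small]) (use \<eta>(2) in blast)
  ultimately show False
    using idx_thin[OF p(1)] thin_if_small by blast
qed

text \<open>A cone either contains a subcone inside \<open>B\<close>, where \<open>A - B\<close> is
  empty, or misses the interior of \<open>B\<close>. In the latter case its trace on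
  \<open>B\<close> is small, hence so is its trace on \<open>A\<close>.\<close>

lemma thin_Diff:
  assumes B: "B \<in> measurables"
    and small: "\<And>x \<xi>. x \<in> X \<Longrightarrow> \<xi> \<in> Field \<kappa> \<Longrightarrow> small (nbhd x \<xi> \<inter> B) \<Longrightarrow> small (nbhd x \<xi> \<inter> A)"
  shows "thin (A - B)"
  unfolding thin_def
proof (intro ballI)
  fix x \<xi> assume x: "x \<in> X" "\<xi> \<in> Field \<kappa>"
  show "\<exists>y\<in>X. \<exists>\<eta>\<in>Field \<kappa>. nbhd y \<eta> \<subseteq> nbhd x \<xi> \<and> small (nbhd y \<eta> \<inter> (A - B))"
  proof (cases "nbhd x \<xi> \<inter> T interior_of B = {}")
    case True
    then have "nbhd x \<xi> \<inter> B \<subseteq> B - T interior_of B" by blast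
    moreover have "small (B - T interior_of B)"
      using B by (simp add: measurables_def)
    ultimately have "small (nbhd x \<xi> \<inter> B)"
      using small_subset by blast
    then have "small (nbhd x \<xi> \<inter> A)"
      using small x by blast
    then have "small (nbhd x \<xi> \<inter> (A - B))"
      by (rule small_subset) blast
    with x show ?thesis by blast
  next
    case False
    then obtain y where y: "y \<in> nbhd x \<xi> \<inter> T interior_of B" by blast
    moreover have "openin T (nbhd x \<xi> \<inter> T interior_of B)"
      using x by (simp add: openin_nbhd openin_Int)
    ultimately obtain \<eta> where \<eta>: "\<eta> \<in> Field \<kappa>" "nbhd y \<eta> \<subseteq> nbhd x \<xi> \<inter> T interior_of B"
      using nbhd_subset_openin by blast
    then have "nbhd y \<eta> \<inter> (A - B) = {}"
      using interior_of_subset[of T B] by blast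
    then have "small (nbhd y \<eta> \<inter> (A - B))"
      by (simp add: finite_imp_small)
    moreover have "y \<in> X" using y nbhd_subset by blast
    ultimately show ?thesis
      using \<eta> by blast
  qed
qed

text \<open>If a cone has small trace on the union of the \<open>B i\<close>, then by
  \<open>small_nbhd_Int_cong\<close> it has small trace on each \<open>A i\<close>, hence on their
  union. So \<open>thin_Diff\<close> applies to the two unions, and \<open>p\<close> contains no
  thin set.\<close>

lemma UN_in_idx_cong:
  assumes I: "small I" and A: "\<And>i. i \<in> I \<Longrightarrow> A i \<in> measurables"
    and B: "\<And>i. i \<in> I \<Longrightarrow> B i \<in> measurables" and eq: "\<And>i. i \<in> I \<Longrightarrow> ind (A i) = ind (B i)"
    and p: "p \<in> idx" "(\<Union>i\<in>I. A i) \<in> p"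
  shows "(\<Union>i\<in>I. B i) \<in> p"
proof -
  have "thin ((\<Union>i\<in>I. A i) - (\<Union>i\<in>I. B i))"
  proof (rule thin_Diff)
    show "(\<Union>i\<in>I. B i) \<in> measurables"
      using I B by (rule measurables_UN)
    fix x \<xi> assume x: "x \<in> X" "\<xi> \<in> Field \<kappa>" and small: "small (nbhd x \<xi> \<inter> (\<Union>i\<in>I. B i))"
    have "small (nbhd x \<xi> \<inter> A i)" if "i \<in> I" for i
    proof (rule small_nbhd_Int_cong[OF A B eq x])
      show "small (nbhd x \<xi> \<inter> B i)"
        by (rule small_subset[OF small]) (use that in blast)
    qed (use that in auto)
    then have "small (\<Union>i\<in>I. nbhd x \<xi> \<inter> A i)"
      by (rule small_UN[OF I])
    then show "small (nbhd x \<xi> \<inter> (\<Union>i\<in>I. A i))"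
      by (simp only: Int_UN_distrib)
  qed
  then have "(\<Union>i\<in>I. A i) - (\<Union>i\<in>I. B i) \<notin> p"
    using p(1) idx_thin by blast
  moreover have "((\<Union>i\<in>I. A i) - (\<Union>i\<in>I. B i)) \<union> (\<Union>i\<in>I. B i) \<in> p"
    by (rule ultrafilter_mono[OF idx_ultrafilter[OF p(1)] p(2)]) blast
  ultimately show ?thesis
    using idx_ultrafilter[OF p(1)] unfolding ultrafilter_def by blast
qed

lemma ind_UN_cong:
  assumes "small I" "\<And>i. i \<in> I \<Longrightarrow> A i \<in> measurables" "\<And>i. i \<in> I \<Longrightarrow> B i \<in> measurables"
    and "\<And>i. i \<in> I \<Longrightarrow> ind (A i) = ind (B i)"
  shows "ind (\<Union>i\<in>I. A i) = ind (\<Union>i\<in>I. B i)"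
proof
  fix p
  have "p \<in> idx \<Longrightarrow> (\<Union>i\<in>I. A i) \<in> p \<longleftrightarrow> (\<Union>i\<in>I. B i) \<in> p"
    using UN_in_idx_cong[of I A B p] UN_in_idx_cong[of I B A p] assms by auto
  then show "ind (\<Union>i\<in>I. A i) p = ind (\<Union>i\<in>I. B i) p"
    by (auto simp: ind_def)
qed

section \<open>The transfinite sum\<close>

text \<open>These are the sequences whose sum is prescribed by (M4).\<close>

definition realizes ::
    "('o::wellorder \<Rightarrow> ('k \<Rightarrow> 'l) set) \<Rightarrow> 'o \<Rightarrow> ('o \<rightharpoonup> (('k \<Rightarrow> 'l) set set \<Rightarrow> int)) \<Rightarrow> bool" where
  "realizes F \<gamma> s \<longleftrightarrow> small {..<\<gamma>} \<and> (\<forall>i<\<gamma>. F i \<in> measurables) \<and> disjoint_family_on F {..<\<gamma>} \<and>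
    s = (\<mu> \<circ> F) |` {..<\<gamma>}"

text \<open>The finite case comes first because (S1) binds all finite sequences, realized or not.
  The chosen value does not depend on the realizing family, by \<open>realizes_unique\<close>. The
  default 0 is what breaks (S2).\<close>

definition total_of ::
    "('o::wellorder \<rightharpoonup> (('k \<Rightarrow> 'l) set set \<Rightarrow> int)) \<Rightarrow> (('k \<Rightarrow> 'l) set set \<Rightarrow> int)" where
  "total_of s =
    (if finite (dom s) then finite_sum S s
     else if \<exists>F \<gamma>. realizes F \<gamma> s then SOME v. \<exists>F \<gamma>. realizes F \<gamma> s \<and> v = ind (\<Union>i<\<gamma>. F i)
     else (\<lambda>_. 0))"

definition \<sigma> :: "('o::wellorder \<rightharpoonup> (('k \<Rightarrow> 'l) set set \<Rightarrow> int)) \<rightharpoonup> (('k \<Rightarrow> 'l) set set \<Rightarrow> int)" where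
  "\<sigma> s = (if s \<in> ord_seqs S then Some (total_of s) else None)"

lemma realizes_dom: "realizes F \<gamma> s \<Longrightarrow> dom s = {..<\<gamma>}"
  by (auto simp: realizes_def restrict_map_def \<mu>_def split: if_splits)

lemma realizes_apply: "realizes F \<gamma> s \<Longrightarrow> i < \<gamma> \<Longrightarrow> s i = Some (ind (F i))"
  by (simp add: realizes_def \<mu>_def)

lemma realizes_ord_seqs:
  assumes "realizes F \<gamma> s"
  shows "s \<in> ord_seqs S"
proof -
  have "v \<in> carrier S" if "s i = Some v" for i v
  proof -
    have "i < \<gamma>" using that realizes_dom[OF assms] by blast
    then show ?thesis
      using that realizes_apply[OF assms] ind_carrier by auto
  qed
  then show ?thesis
    using realizes_dom[OF assms] unfolding ord_seqs_def ran_def by blast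
qed

text \<open>Both families have the length of \<open>s\<close>, and their members have equal measures
  index by index, so \<open>ind_UN_cong\<close> compares the unions.\<close>

lemma realizes_unique:
  assumes F: "realizes F \<gamma> s" and G: "realizes G \<delta> s"
  shows "ind (\<Union>i<\<gamma>. F i) = ind (\<Union>i<\<delta>. G i)"
proof -
  have "\<gamma> = \<delta>"
    using realizes_dom[OF F] realizes_dom[OF G] by simp
  moreover have "ind (\<Union>i<\<gamma>. F i) = ind (\<Union>i<\<gamma>. G i)"
  proof (rule ind_UN_cong)
    fix i assume "i \<in> {..<\<gamma>}"
    then show "ind (F i) = ind (G i)"
      using realizes_apply[OF F, of i] realizes_apply[OF G, of i] \<open>\<gamma> = \<delta>\<close> by simp
  qed (use F G \<open>\<gamma> = \<delta>\<close> in \<open>auto simp: realizes_def\<close>)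
  ultimately show ?thesis by simp
qed

lemma finite_sum_apply:
  fixes s :: "'o::wellorder \<rightharpoonup> (('k \<Rightarrow> 'l) set set \<Rightarrow> int)"
  assumes "finite (dom s)"
  shows "finite_sum S s p = (\<Sum>i\<in>dom s. the (s i) p)"
proof -
  have "foldr (mult S) (map f xs) (one S) p = (\<Sum>i\<leftarrow>xs. f i p)"
    for f :: "'o \<Rightarrow> ('k \<Rightarrow> 'l) set set \<Rightarrow> int" and xs
    by (induction xs) (simp_all add: lex_monoid_def)
  from this[of "\<lambda>i. the (s i)" "sorted_list_of_set (dom s)"] show ?thesis
    using assms by (simp add: finite_sum_def sum_list_distinct_conv_sum_set)
qed

text \<open>For finite sequences this is finite additivity, for infinite ones independence of the
  realizing family.\<close>

lemma total_of_realized: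
  assumes "realizes F \<gamma> s"
  shows "total_of s = ind (\<Union>i<\<gamma>. F i)"
proof (cases "finite (dom s)")
  case True
  have "finite_sum S s p = ind (\<Union>i<\<gamma>. F i) p" for p
  proof -
    have "finite_sum S s p = (\<Sum>i<\<gamma>. the (s i) p)"
      using finite_sum_apply[OF True] realizes_dom[OF assms] by simp
    also have "\<dots> = (\<Sum>i<\<gamma>. ind (F i) p)"
      using realizes_apply[OF assms] by (intro sum.cong) auto
    also have "\<dots> = ind (\<Union>i<\<gamma>. F i) p"
      using True realizes_dom[OF assms] assms
      by (intro ind_UN_disjoint[symmetric]) (auto simp: realizes_def)
    finally show ?thesis .
  qed
  with True show ?thesis by (auto simp: total_of_def)
next
  case False
  let ?P = "\<lambda>v. \<exists>F \<gamma>. realizes F \<gamma> s \<and> v = ind (\<Union>i<\<gamma>. F i)"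
  have "?P (ind (\<Union>i<\<gamma>. F i))" using assms by blast
  then have "?P (SOME v. ?P v)" by (rule someI[of ?P])
  then obtain G \<delta> where "realizes G \<delta> s" "(SOME v. ?P v) = ind (\<Union>i<\<delta>. G i)"
    by blast
  then have "(SOME v. ?P v) = ind (\<Union>i<\<gamma>. F i)"
    using realizes_unique[OF _ assms] by metis
  moreover have "\<exists>F \<gamma>. realizes F \<gamma> s" using assms by blast
  ultimately show ?thesis
    using False by (simp add: total_of_def)
qed

lemma total_of_carrier:
  assumes s: "s \<in> ord_seqs S"
  shows "total_of s \<in> carrier S"
proof -
  interpret pos_tot_ord_monoid S by (rule pos_tot_ord_monoid_S)
  have "finite_sum S s \<in> carrier S" if fin: "finite (dom s)"
  proof -
    have "foldr (mult S) ys (one S) \<in> carrier S" if "set ys \<subseteq> carrier S" for ys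
      using that by (induction ys) auto
    moreover have "the (s i) \<in> carrier S" if "i \<in> dom s" for i
      using that s by (auto simp: ord_seqs_def ran_def)
    then have "set (map (\<lambda>i. the (s i)) (sorted_list_of_set (dom s))) \<subseteq> carrier S"
      using fin by auto
    ultimately show ?thesis
      unfolding finite_sum_def by blast
  qed
  moreover have "total_of s \<in> carrier S" if "realizes F \<gamma> s" for F \<gamma>
    using total_of_realized[OF that] ind_carrier by simp
  ultimately show ?thesis
    using zero_carrier unfolding total_of_def by presburger
qed

lemma partial_Sum_\<sigma>: "partial_Sum S \<sigma>"
  unfolding partial_Sum_def
proof
  show "dom \<sigma> \<subseteq> ord_seqs S"
    by (auto simp: \<sigma>_def split: if_splits)
  show "ran \<sigma> \<subseteq> carrier S"
    using total_of_carrier by (auto simp: ran_def \<sigma>_def split: if_splits)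
qed

lemma Sum_S1_\<sigma>: "Sum_S1 S (\<sigma> :: ('o::wellorder \<rightharpoonup> _) \<rightharpoonup> _)"
proof -
  \<comment> \<open>The least element of \<open>'o\<close> represents the length 0.\<close>
  have "{..<(LEAST \<gamma>. True) :: 'o} = {}"
    using not_less_Least by blast
  then have "(Map.empty :: 'o \<rightharpoonup> _) \<in> ord_seqs S"
    unfolding ord_seqs_def by (auto intro!: exI[of _ "LEAST \<gamma>. True"])
  then show ?thesis
    by (auto simp: Sum_S1_def \<sigma>_def total_of_def finite_sum_def split: if_splits)
qed

section \<open>Failure of continuity\<close>

text \<open>If all initial segments were finite, their cardinalities would embed \<open>'o\<close>
  into the natural numbers, although \<open>'o\<close> is larger than the infinite
  \<open>lam\<close>.\<close>

lemma ex_infinite_lessThan: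
  assumes "lam <o |UNIV :: 'o::wellorder set|"
  shows "\<exists>\<gamma>::'o. infinite {..<\<gamma>}"
proof (rule ccontr)
  assume "\<nexists>\<gamma>::'o. infinite {..<\<gamma>}"
  then have fin: "finite {..<\<gamma>}" for \<gamma> :: 'o by blast
  have "strict_mono (\<lambda>\<gamma>::'o. card {..<\<gamma>})"
  proof (rule strict_monoI)
    fix \<beta> \<gamma> :: 'o assume "\<beta> < \<gamma>"
    then have "{..<\<beta>} \<subset> {..<\<gamma>}" by auto
    with fin show "card {..<\<beta>} < card {..<\<gamma>}" by (rule psubset_card_mono)
  qed
  then have "inj (\<lambda>\<gamma>::'o. card {..<\<gamma>})"
    by (rule strict_mono_imp_inj_on)
  then have "|UNIV :: 'o set| \<le>o |UNIV :: nat set|"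
    by (rule card_of_ordLeqI) simp
  also have "|UNIV :: nat set| =o natLeq"
    by (rule card_of_nat)
  also have "natLeq \<le>o lam"
    using lam by (rule natLeq_ordLeq_cinfinite)
  finally show False
    using assms not_ordLess_ordLeq by blast
qed

text \<open>The counterexample is a constant sequence of length \<omega> with nonzero finite partial
  sums but sum 0 by default.\<close>

lemma not_Sum_S2_\<sigma>:
  assumes "lam <o |UNIV :: 'o::wellorder set|"
  shows "\<not> Sum_S2 S (\<sigma> :: ('o \<rightharpoonup> _) \<rightharpoonup> _)"
proof
  assume S2: "Sum_S2 S (\<sigma> :: ('o \<rightharpoonup> _) \<rightharpoonup> _)"
  \<comment> \<open>The representative of \<omega>.\<close>
  define \<gamma> :: 'o where "\<gamma> = (LEAST \<gamma>. infinite {..<\<gamma>})"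
  have inf: "infinite {..<\<gamma>}"
    using ex_infinite_lessThan[OF assms] unfolding \<gamma>_def by (metis (mono_tags, lifting) LeastI_ex)
  have fin: "finite {..<\<beta>}" if "\<beta> < \<gamma>" for \<beta>
    using that not_less_Least unfolding \<gamma>_def by blast
  have succ: "\<exists>\<delta><\<gamma>. \<beta> < \<delta>" if "\<beta> < \<gamma>" for \<beta>
  proof (rule ccontr)
    assume "\<not> (\<exists>\<delta><\<gamma>. \<beta> < \<delta>)"
    then have "{..<\<gamma>} \<subseteq> insert \<beta> {..<\<beta>}"
      by (force simp: neq_iff)
    then show False
      using inf fin[OF that] finite_subset by blast
  qed
  have "{..<\<gamma>} \<noteq> {}" using inf by auto
  then obtain \<beta> where "\<beta> < \<gamma>" by blast
  \<comment> \<open>A length with at least one predecessor, so that the partial sum up to \<delta>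
    is not empty.\<close>
  then obtain \<delta> where \<delta>: "\<beta> < \<delta>" "\<delta> < \<gamma>" using succ by blast
  \<comment> \<open>Twice the measure of the whole space: its value 2 at the indices is not attained
    by any indicator, so no family of sets realizes the sequence.\<close>
  define c where "c = (\<lambda>p. ind X p + ind X p)"
  have c_carrier: "c \<in> carrier S"
    by (auto simp: c_def ind_def lex_monoid_def intro!: lex_nonneg_if_nonneg)
  define s :: "'o \<rightharpoonup> _" where "s = (\<lambda>i. if i < \<gamma> then Some c else None)"
  have dom_s: "dom s = {..<\<gamma>}" by (auto simp: s_def split: if_splits)
  have dom_restr: "dom (s |` {..<\<alpha>}) = {..<\<alpha>}" if "\<alpha> < \<gamma>" for \<alpha>
    using that dom_s by auto
  have ran: "ran s \<subseteq> carrier S" "ran (s |` {..<\<alpha>}) \<subseteq> carrier S" for \<alpha>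
    using c_carrier by (auto simp: ran_def s_def restrict_map_def split: if_splits)
  have s: "s \<in> ord_seqs S" and restr: "s |` {..<\<alpha>} \<in> ord_seqs S" if "\<alpha> < \<gamma>" for \<alpha>
    using ran dom_s dom_restr[OF that] unfolding ord_seqs_def by blast+
  obtain p where p: "p \<in> idx" using idx_nonempty by blast
  then have "c p = 2"
    using X_in_idx by (simp add: c_def ind_def)
  have "\<not> realizes F \<epsilon> s" for F \<epsilon>
  proof
    assume *: "realizes F \<epsilon> s"
    then have "\<beta> < \<epsilon>" using realizes_dom dom_s \<open>\<beta> < \<gamma>\<close> by blast
    then have "c = ind (F \<beta>)"
      using realizes_apply[OF *, of \<beta>] \<open>\<beta> < \<gamma>\<close> by (simp add: s_def)
    then show False using \<open>c p = 2\<close> by (simp add: ind_def of_bool_def split: if_splits)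
  qed
  then have "total_of s = (\<lambda>_. 0)"
    using inf dom_s by (simp add: total_of_def)
  then have \<sigma>_s: "\<sigma> s = Some (\<lambda>_. 0)"
    using s[OF \<open>\<beta> < \<gamma>\<close>] by (simp add: \<sigma>_def)
  have lh: "lh s = \<gamma>"
    unfolding lh_def dom_s by (rule the_equality) auto
  have dom_\<sigma>: "s |` {..<\<alpha>} \<in> dom \<sigma>" if "\<alpha> < \<gamma>" for \<alpha>
    using restr[OF that] by (simp add: \<sigma>_def dom_def)
  have "is_limit (lh s) \<and> (\<forall>\<beta><lh s. \<exists>\<alpha><lh s. \<beta> \<le> \<alpha> \<and> s |` {..<\<alpha>} \<in> dom \<sigma>)"
    using succ \<open>\<beta> < \<gamma>\<close> dom_\<sigma> unfolding lh is_limit_def by blast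
  then have "is_sup S {the (\<sigma> (s |` {..<\<alpha>})) | \<alpha>. \<alpha> < lh s \<and> s |` {..<\<alpha>} \<in> dom \<sigma>} (the (\<sigma> s))"
    using S2 \<sigma>_s unfolding Sum_S2_def by blast
  then have "(the (\<sigma> (s |` {..<\<delta>})), the (\<sigma> s)) \<in> leq S"
    using dom_\<sigma>[OF \<delta>(2)] \<delta>(2) lh unfolding is_sup_def by blast
  moreover have "the (\<sigma> (s |` {..<\<delta>})) = finite_sum S (s |` {..<\<delta>})"
    using restr[OF \<delta>(2)] fin[OF \<delta>(2)] dom_restr[OF \<delta>(2)] by (simp add: \<sigma>_def total_of_def)
  ultimately have "(finite_sum S (s |` {..<\<delta>}), \<lambda>_. 0) \<in> leq S"
    using \<sigma>_s by simp
  then have "finite_sum S (s |` {..<\<delta>}) p = 0"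
    using lex_nonneg_antisym[OF idx_less(1), of "finite_sum S (s |` {..<\<delta>})"]
    by (simp add: lex_monoid_def)
  moreover have "finite_sum S (s |` {..<\<delta>}) p = (\<Sum>i<\<delta>. the ((s |` {..<\<delta>}) i) p)"
    using finite_sum_apply[of "s |` {..<\<delta>}" p] fin[OF \<delta>(2)] dom_restr[OF \<delta>(2)] by simp
  moreover have "\<dots> = (\<Sum>i<\<delta>. c p)"
    using \<delta>(2) by (intro sum.cong) (auto simp: s_def)
  ultimately have "card {..<\<delta>} = 0"
    using \<open>c p = 2\<close> by simp
  then show False
    using fin[OF \<delta>(2)] \<delta>(1) by auto
qed

section \<open>The measure axioms\<close>

text \<open>A lower bound \<open>y\<close> vanishes at every index, by induction along
  \<open>idx_less\<close>: for each \<open>p\<close> some basis member has an indicator that is zero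
  at \<open>p\<close> and at all earlier indices, which leaves no room for
  \<open>y p > 0\<close>.\<close>

lemma is_inf_local_basis:
  assumes "local_basis_at T x (F ` I)" "x \<in> X"
  shows "is_inf S ((\<lambda>i. the (\<mu> (F i))) ` I) (\<lambda>_. 0)"
  unfolding is_inf_def
proof (intro conjI ballI impI)
  interpret pos_tot_ord_monoid S by (rule pos_tot_ord_monoid_S)
  show "(\<lambda>_. 0) \<in> carrier S" by (rule zero_carrier)
  have \<mu>: "the (\<mu> (F i)) = ind (F i)" if "i \<in> I" for i
    using that assms(1) measurables_openin by (auto simp: local_basis_at_def \<mu>_def)
  show "(\<lambda>_. 0, a) \<in> leq S" if "a \<in> (\<lambda>i. the (\<mu> (F i))) ` I" for a
    using that \<mu> zero_min[OF ind_carrier] by (auto simp: lex_monoid_def)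
  fix y assume y: "y \<in> carrier S" "\<forall>a\<in>(\<lambda>i. the (\<mu> (F i))) ` I. (y, a) \<in> leq S"
  have "y p = 0" for p
    using idx_less(1)
  proof (induction p rule: wf_induct_rule)
    case (less p)
    show ?case
    proof (cases "p \<in> idx")
      case True
      have "openin T (nbhd x (rank p))" "x \<in> nbhd x (rank p)"
        using openin_nbhd mem_nbhd assms(2) rank(1)[OF True] by auto
      \<comment> \<open>The level \<open>rank p\<close> is the one for which
        \<open>nbhd_notin_below\<close> covers \<open>p\<close> and all its predecessors at
        once.\<close>
      then obtain i where i: "i \<in> I" "F i \<subseteq> nbhd x (rank p)"
        using assms(1) unfolding local_basis_at_def by blast
      have ind_zero: "ind (F i) q = 0" if "(q, p) \<in> idx_less \<or> q = p" for q
        using nbhd_notin_below[OF assms(2) True _ that] i(2)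
          ultrafilter_mono[OF idx_ultrafilter, of q "F i"] by (auto simp: ind_def)
      have "(y, ind (F i)) \<in> leq S"
        using y(2) \<mu> i(1) by force
      then have "lex_nonneg idx_less y" "lex_nonneg idx_less (\<lambda>q. ind (F i) q - y q)"
        by (auto simp: lex_monoid_def)
      moreover have "ind (F i) q - y q = 0" "y q = 0" if "(q, p) \<in> idx_less" for q
        using less that ind_zero by simp_all
      ultimately have "0 \<le> y p" "0 \<le> ind (F i) p - y p"
        unfolding lex_nonneg_def by blast+
      then show ?thesis
        using ind_zero[of p] by simp
    qed (use y(1) in \<open>auto simp: lex_monoid_def\<close>)
  qed
  then have "y = (\<lambda>_. 0)" by blast
  then show "(y, \<lambda>_. 0) \<in> leq S"
    using zero_min[OF zero_carrier] by (simp add: lex_monoid_def)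
qed

lemma weak_measure_space_\<mu>: "weak_measure_space lam S (\<sigma> :: ('o::wellorder \<rightharpoonup> _) \<rightharpoonup> _) T measurables \<mu>"
proof
  interpret pos_tot_ord_monoid S by (rule pos_tot_ord_monoid_S)
  have zero: "\<one>\<^bsub>S\<^esub> = (\<lambda>_. 0)" by (simp add: lex_monoid_def)
  have empty: "{} \<in> measurables"
    by (simp add: measurables_small finite_imp_small)
  have topspace: "topspace T \<in> measurables"
    by (simp add: measurables_openin)
  show "weakly_measurable_space lam T measurables"
    by (rule weakly_measurable_space_measurables)
  show "dom \<mu> \<subseteq> Pow (topspace T)"
    by (auto simp: \<mu>_def measurables_def topspace_T split: if_splits)
  show "ran \<mu> \<subseteq> carrier S"
    using ind_carrier by (auto simp: ran_def \<mu>_def split: if_splits)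
  show "measurables \<subseteq> dom \<mu>"
    by (auto simp: \<mu>_def)
  show "\<mu> {} = Some \<one>\<^bsub>S\<^esub>"
    using empty ind_thin[of "{}"] by (simp add: \<mu>_def zero thin_if_small finite_imp_small)
  show "(\<one>\<^bsub>S\<^esub>, the (\<mu> (topspace T))) \<in> leq S"
    using topspace zero_min[OF ind_carrier] by (simp add: \<mu>_def)
  obtain p where "p \<in> idx" using idx_nonempty by blast
  then have "ind (topspace T) p = 1"
    using X_in_idx by (simp add: ind_def topspace_T)
  then show "the (\<mu> (topspace T)) \<noteq> \<one>\<^bsub>S\<^esub>"
    using topspace by (auto simp: \<mu>_def zero)
  show "(the (\<mu> A), the (\<mu> B)) \<in> leq S" if "A \<in> measurables" "B \<in> measurables" "A \<subseteq> B" for A B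
    using that ind_mono by (simp add: \<mu>_def)
  show "(\<mu> \<circ> F) |` {..<\<gamma>} \<in> dom \<sigma> \<and> \<mu> (\<Union>i<\<gamma>. F i) = \<sigma> ((\<mu> \<circ> F) |` {..<\<gamma>})"
    if "|{..<\<gamma>}| <o cardSuc lam" and F: "\<And>i. i < \<gamma> \<Longrightarrow> F i \<in> measurables"
      and "disjoint_family_on F {..<\<gamma>}" for \<gamma> :: 'o and F
  proof -
    have small: "small {..<\<gamma>}"
      using that(1) lam cardSuc_ordLeq_ordLess[of lam "|{..<\<gamma>}|"] by (simp add: card_of_Card_order)
    \<comment> \<open>The family realizes its own sequence of measures, so
      \<open>total_of_realized\<close> identifies the sum with the measure of the union.\<close>
    then have realizes: "realizes F \<gamma> ((\<mu> \<circ> F) |` {..<\<gamma>})"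
      using that by (simp add: realizes_def)
    have "(\<Union>i<\<gamma>. F i) \<in> measurables"
      using small F by (intro measurables_UN) auto
    then show ?thesis
      using realizes_ord_seqs[OF realizes] total_of_realized[OF realizes]
      by (auto simp: \<sigma>_def \<mu>_def)
  qed
  show "is_inf S ((\<lambda>i. the (\<mu> (F i))) ` {..<\<gamma>}) (the (\<mu> {x}))"
    if "x \<in> topspace T" "{x} \<in> measurables" "local_basis_at T x (F ` {..<\<gamma>})" for x F and \<gamma> :: 'o
    using is_inf_local_basis[OF that(3)] that(1,2) ind_thin[of "{x}"]
    by (simp add: topspace_T \<mu>_def thin_if_small finite_imp_small)
qed

lemma continuous_measure_\<mu>: "continuous_measure S T measurables \<mu>"
proof -
  have "small {x}" for x :: "'k \<Rightarrow> 'l" by (simp add: finite_imp_small)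
  then have "{x} \<in> measurables" "ind {x} = (\<lambda>_. 0)" if "x \<in> X" for x
    using that by (simp_all add: measurables_small ind_thin thin_if_small)
  then show ?thesis
    by (simp add: continuous_measure_def topspace_T \<mu>_def lex_monoid_def)
qed

section \<open>Support and weight\<close>

text \<open>A nonempty open set contains a cone, and by \<open>ex_idx\<close> some index contains
  that cone, so the open set is not null.\<close>

lemma supp_\<mu>: "supp S T \<mu> = topspace T"
proof -
  have "U = {}" if U: "openin T U" "\<mu> U = Some \<one>\<^bsub>S\<^esub>" for U
  proof (rule ccontr)
    assume "U \<noteq> {}"
    then obtain x where "x \<in> U" by blast
    then obtain \<xi> where \<xi>: "\<xi> \<in> Field \<kappa>" "nbhd x \<xi> \<subseteq> U"
      using nbhd_subset_openin U(1) by blast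
    have "x \<in> X"
      using \<open>x \<in> U\<close> openin_subset[OF U(1)] topspace_T by blast
    then obtain p where p: "p \<in> idx" "nbhd x \<xi> \<in> p"
      using ex_idx \<xi>(1) by blast
    then have "U \<in> p"
      using ultrafilter_mono[OF idx_ultrafilter] \<xi>(2) by blast
    then have "ind U p = 1" using p(1) by (simp add: ind_def)
    moreover have "ind U = (\<lambda>_. 0)"
      using U measurables_openin by (simp add: \<mu>_def lex_monoid_def)
    ultimately show False by simp
  qed
  then show ?thesis by (auto simp: supp_def)
qed

text \<open>The constant sequences have pairwise disjoint cones at a suitable level. A base has a
  nonempty member inside each of these \<open>lam\<close> many cones.\<close>

lemma lam_ordLeq_base:
  assumes base: "is_base T \<B>"
  shows "lam \<le>o |\<B>|"
proof -
  obtain \<xi> where \<xi>: "\<xi> \<in> Field \<kappa>" using infinite_Field(1) by fastforce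
  \<comment> \<open>Cones of level \<eta> fix the coordinate \<xi> and thus separate distinct
    constant sequences.\<close>
  then obtain \<eta> where \<eta>: "\<eta> \<in> Field \<kappa>" "\<xi> \<in> underS \<kappa> \<eta>"
    using ex_greater by blast
  define x where "x = (\<lambda>(c :: 'l) \<beta>. if \<beta> \<in> Field \<kappa> then c else undefined)"
  have x: "x c \<in> X" if "c \<in> Field lam" for c
    using that by (auto simp: x_def long_seqs_def Func_def)
  have "\<exists>B\<in>\<B>. x c \<in> B \<and> B \<subseteq> nbhd (x c) \<eta>" if "c \<in> Field lam" for c
  proof -
    have "(arbitrary union_of (\<lambda>B. B \<in> \<B>)) (nbhd (x c) \<eta>)"
      using openin_nbhd[OF x[OF that] \<eta>(1)] base unfolding is_base_def by simp
    then obtain \<U> where \<U>: "\<U> \<subseteq> \<B>" "\<Union>\<U> = nbhd (x c) \<eta>"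
      by (auto simp: union_of_def)
    then have "x c \<in> \<Union>\<U>"
      using mem_nbhd[OF x[OF that]] by simp
    then obtain B where "B \<in> \<U>" "x c \<in> B" by blast
    with \<U> Union_upper[of B \<U>] show ?thesis by auto
  qed
  then obtain B where B: "\<And>c. c \<in> Field lam \<Longrightarrow> B c \<in> \<B> \<and> x c \<in> B c \<and> B c \<subseteq> nbhd (x c) \<eta>"
    by metis
  have "inj_on B (Field lam)"
  proof (rule inj_onI)
    fix c d assume "c \<in> Field lam" "d \<in> Field lam" "B c = B d"
    then have "x c \<in> nbhd (x d) \<eta>" using B by blast
    then have "x c \<xi> = x d \<xi>"
      using \<eta>(2) by (simp add: nbhd_def)
    then show "c = d" using \<xi> by (simp add: x_def)
  qed
  then have "|Field lam| \<le>o |\<B>|"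
    by (rule card_of_ordLeqI) (use B in blast)
  moreover have "lam =o |Field lam|"
    using lam card_of_Field_ordIso ordIso_symmetric by blast
  ultimately show ?thesis
    using ordIso_ordLeq_trans by blast
qed

lemma not_Dirac_\<mu>: "\<not> Dirac lam S T \<mu>"
proof -
  obtain \<B> where "is_base T \<B>" "weight T = |\<B>|"
    by (rule weight_witness)
  then have "lam \<le>o weight T"
    using lam_ordLeq_base by simp
  then show ?thesis
    using not_ordLess_ordLeq by (auto simp: Dirac_def supp_\<mu>)
qed

end

theorem theorem5p17:
  fixes \<kappa> :: "'k rel" and lam :: "'l rel"
  assumes "Cinfinite \<kappa>" and "Cinfinite lam"
    and "regularCard \<kappa>"
    and "\<kappa> \<le>o lam"
    and "|short_seqs \<kappa> lam| =o lam"
    and "lam <o lam ^c \<kappa>"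
    and "lam <o |UNIV :: 'o::wellorder set|"
  shows "\<exists>(S :: (('k \<Rightarrow> 'l) set set \<Rightarrow> int) ordered_monoid)
      (\<sigma> :: ('o \<rightharpoonup> (('k \<Rightarrow> 'l) set set \<Rightarrow> int)) \<rightharpoonup> (('k \<Rightarrow> 'l) set set \<Rightarrow> int)) \<MM> \<mu>.
    pos_tot_ord_monoid S \<and>
    partial_Sum S \<sigma> \<and> Sum_S1 S \<sigma> \<and> \<not> Sum_S2 S \<sigma> \<and>
    weak_measure_space lam S \<sigma> (bounded_topology \<kappa> lam) \<MM> \<mu> \<and>
    continuous_measure S (bounded_topology \<kappa> lam) \<MM> \<mu> \<and>
    \<not> Dirac lam S (bounded_topology \<kappa> lam) \<mu>"
proof -
  interpret generalized_baire \<kappa> lam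
    using assms by unfold_locales (auto intro: ordIso_imp_ordLeq)
  let ?\<sigma> = "\<sigma> :: ('o \<rightharpoonup> _) \<rightharpoonup> _"
  show ?thesis
  proof (intro exI conjI)
    show "pos_tot_ord_monoid S" by (rule pos_tot_ord_monoid_S)
    show "partial_Sum S ?\<sigma>" by (rule partial_Sum_\<sigma>)
    show "Sum_S1 S ?\<sigma>" by (rule Sum_S1_\<sigma>)
    show "\<not> Sum_S2 S ?\<sigma>" using assms(7) by (rule not_Sum_S2_\<sigma>)
    show "weak_measure_space lam S ?\<sigma> T measurables \<mu>" by (rule weak_measure_space_\<mu>)
    show "continuous_measure S T measurables \<mu>" by (rule continuous_measure_\<mu>)
    show "\<not> Dirac lam S T \<mu>" by (rule not_Dirac_\<mu>)
  qed
qed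

end
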